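(* Let $r\ge1$ and let $C_r$ be the Young diagram consisting of a single column of $r$ boxes. There exist mutually inverse crystal isomorphisms $$\Psi:B(C_r)\otimes\mathbf B\to\mathbf B\otimes B(C_r),\qquad \Psi^{-1}:\mathbf B\otimes B(C_r)\to B(C_r)\otimes\mathbf B,$$ where, writing $(a_1,\dots,a_r)$ for the column tableau with entries $a_1,\dots,a_r$ from top to bottom, the correspondences are as follows. (i) If the two-box column with $a_r$ above $b$ is semistandard, then $\Psi\big((a_1,\dots,a_r)\otimes b\big)=a_1\otimes(a_2,\dots,a_r,b)$. If the two-box row with $b$ to the left of $a_r$ is semistandard, then $\Psi\big((a_1,\dots,a_r)\otimes b\big)=a_\nu\otimes(a_1,\dots,a_{\nu-1},b,a_{\nu+1},\dots,a_r)$, where $\nu$ is the smallest integer such that the two-box row with $b$ to the left of $a_\nu$ is semistandard. (ii) If the two-box column with $b$ above $a_1$ is semistandard, then $\Psi^{-1}\big(b\otimes(a_1,\dots,a_r)\big)=(b,a_1,\dots,a_{r-1})\otimes a_r$. If the two-box row with $a_1$ to the left of $b$ is semistandard, then $\Psi^{-1}\big(b\otimes(a_1,\dots,a_r)\big)=(a_1,\dots,a_{\nu-1},b,a_{\nu+1},\dots,a_r)\otimes a_\nu$, where $\nu$ is the largest integer such that the two-box row with $a_\nu$ to the left of $b$ is semistandard.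
   Context: Fix integers $m,n\ge1$. $I=\{\overline{m-1},\dots,\overline1,0,1,\dots,n-1\}$. $\mathbf B=\mathbf B_+\sqcup\mathbf B_-$, $\mathbf B_+=\{\overline m,\dots,\overline1\}$, $\mathbf B_-=\{1,\dots,n\}$, ordered by $\overline m<\overline{m-1}<\dots<\overline1<1<2<\dots<n$; $P=\bigoplus_{b\in\mathbf B}\mathbb Z\epsilon_b$. $\mathbf B$ is a crystal with $\mathrm{wt}(b)=\epsilon_b$ and $\tilde f_ib=b'$ (equivalently $\tilde e_ib'=b$) exactly for $(i,b,b')=(\overline k,\overline{k+1},\overline k)$ ($1\le k\le m-1$), $(0,\overline1,1)$, $(k,k,k+1)$ ($1\le k\le n-1$); all other values are $0$. For an element $b$ of a crystal put $\varepsilon_i(b)=\max\{r\ge0:\tilde e_i^rb\ne0\}$, $\varphi_i(b)=\max\{r\ge0:\tilde f_i^rb\ne0\}$. The tensor product of crystals has weights $\mathrm{wt}(b_1\otimes b_2)=\mathrm{wt}(b_1)+\mathrm{wt}(b_2)$ and operators (with $0\otimes b=b\otimes 0=0$): - $i=\overline k$: $\tilde e_i(b_1\otimes b_2)=\tilde e_ib_1\otimes b_2$ if $\varphi_i(b_1)\ge\varepsilon_i(b_2)$, else $b_1\otimes\tilde e_ib_2$; $\tilde f_i(b_1\otimes b_2)=\tilde f_ib_1\otimes b_2$ if $\varphi_i(b_1)>\varepsilon_i(b_2)$, else $b_1\otimes\tilde f_ib_2$. - $i\in\{1,\dots,n-1\}$: $\tilde e_i(b_1\otimes b_2)=b_1\otimes\tilde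 e_ib_2$ if $\varphi_i(b_2)\ge\varepsilon_i(b_1)$, else $\tilde e_ib_1\otimes b_2$; $\tilde f_i(b_1\otimes b_2)=b_1\otimes\tilde f_ib_2$ if $\varphi_i(b_2)>\varepsilon_i(b_1)$, else $\tilde f_ib_1\otimes b_2$. - $i=0$: with $\langle h_0,\sum_b\lambda_b\epsilon_b\rangle=\lambda_{\overline1}+\lambda_1$, the operators $\tilde e_0,\tilde f_0$ act on the first factor if $\langle h_0,\mathrm{wt}(b_1)\rangle>0$, and on the second factor if $\langle h_0,\mathrm{wt}(b_1)\rangle=0$. A semistandard tableau is a filling with elements of $\mathbf B$, weakly increasing along rows from left to right with only elements of $\mathbf B_+$ allowed to repeat in a row, and weakly increasing down columns with only elements of $\mathbf B_-$ allowed to repeat in a column. Thus a two-box row with $x$ left of $y$ is semistandard iff $x<y$ or $x=y\in\mathbf B_+$; a two-box column with $x$ above $y$ is semistandard iff $x<y$ or $x=y\in\mathbf B_-$; for any $a,b$ exactly one of "row ($b$ left of $a$)", "column ($a$ above $b$)" is semistandard. $B(Y)$ is the set of semistandard tableaux of shape $Y$; $B(C_r)$ is a crystal via the identification of a column tableau $(a_1,\dots,a_r)$ with $a_1\otimes\dots\otimes a_r\in\mathbf B^{\otimes r}$ (the image together with $0$ is stable under the operators). A crystal isomorphism is a weight-preserving bijection commuting with all $\tilde e_i,\tilde f_i$ ($0\mapsto0$). *)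

theory Defs
  imports "HOL-Library.Poly_Mapping"
begin

text \<open>
  Letters and colours are integers: the symbol \<open>k\<close> with an overline is encoded as \<open>- k\<close>, the
  symbol \<open>k\<close> without one as \<open>k\<close>. The order on letters is then that of \<open>int\<close>; \<open>0\<close> is a
  colour but not a letter.
\<close>

type_synonym letter = int
type_synonym colour = int

definition B_plus :: "nat \<Rightarrow> letter set"
  where "B_plus m = {- int m..-1}"

definition B_minus :: "nat \<Rightarrow> letter set"
  where "B_minus n = {1..int n}"

definition letters :: "nat \<Rightarrow> nat \<Rightarrow> letter set"
  where "letters m n = B_plus m \<union> B_minus n"

definition colours :: "nat \<Rightarrow> nat \<Rightarrow> colour set"
  where "colours m n = {- (int m - 1)..int n - 1}"

text \<open>
  The weight lattice is the free abelian group on the letters, with \<open>\<epsilon>\<^sub>b\<close> being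
  \<open>Poly_Mapping.single b 1\<close>. The value \<open>None\<close> of an operator plays the role of \<open>0\<close>.
\<close>

type_synonym weight = "letter \<Rightarrow>\<^sub>0 int"

record 'a crystal =
  carrier :: "'a set"
  wt :: "'a \<Rightarrow> weight"
  e_op :: "colour \<Rightarrow> 'a \<Rightarrow> 'a option"
  f_op :: "colour \<Rightarrow> 'a \<Rightarrow> 'a option"

definition iterate :: "('a \<Rightarrow> 'a option) \<Rightarrow> nat \<Rightarrow> 'a \<Rightarrow> 'a option"
  where "iterate g k x = ((\<lambda>y. Option.bind y g) ^^ k) (Some x)"

definition eps :: "'a crystal \<Rightarrow> colour \<Rightarrow> 'a \<Rightarrow> nat"
  where "eps C i x = Max {k. iterate (e_op C i) k x \<noteq> None}"

definition phi :: "'a crystal \<Rightarrow> colour \<Rightarrow> 'a \<Rightarrow> nat"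
  where "phi C i x = Max {k. iterate (f_op C i) k x \<noteq> None}"

definition h0 :: "weight \<Rightarrow> int"
  where "h0 v = Poly_Mapping.lookup v (-1) + Poly_Mapping.lookup v 1"

definition tensor :: "'a crystal \<Rightarrow> 'b crystal \<Rightarrow> ('a \<times> 'b) crystal"
  where "tensor C D = \<lparr>
    carrier = carrier C \<times> carrier D,
    wt = (\<lambda>(x, y). wt C x + wt D y),
    e_op = (\<lambda>i (x, y).
      let first = map_option (\<lambda>x'. (x', y)) (e_op C i x);
          second = map_option (\<lambda>y'. (x, y')) (e_op D i y)
      in if i < 0 then (if phi C i x \<ge> eps D i y then first else second)
         else if i > 0 then (if phi D i y \<ge> eps C i x then second else first)
         else (if h0 (wt C x) > 0 then first else second)),
    f_op = (\<lambda>i (x, y).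
      let first = map_option (\<lambda>x'. (x', y)) (f_op C i x);
          second = map_option (\<lambda>y'. (x, y')) (f_op D i y)
      in if i < 0 then (if phi C i x > eps D i y then first else second)
         else if i > 0 then (if phi D i y > eps C i x then second else first)
         else (if h0 (wt C x) > 0 then first else second))\<rparr>"

text \<open>
  The arrow of colour \<open>i\<close> in the crystal of letters joins \<open>i - 1\<close> to \<open>i\<close> for \<open>i < 0\<close>,
  \<open>-1\<close> to \<open>1\<close> for \<open>i = 0\<close>, and \<open>i\<close> to \<open>i + 1\<close> for \<open>i > 0\<close>.
\<close>

definition arrow_source :: "colour \<Rightarrow> letter"
  where "arrow_source i = (if i \<le> 0 then i - 1 else i)"

definition arrow_target :: "colour \<Rightarrow> letter"
  where "arrow_target i = (if i < 0 then i else i + 1)"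

definition letter_crystal :: "nat \<Rightarrow> nat \<Rightarrow> letter crystal"
  where "letter_crystal m n = \<lparr>
    carrier = letters m n,
    wt = (\<lambda>b. Poly_Mapping.single b 1),
    e_op = (\<lambda>i b. if i \<in> colours m n \<and> b = arrow_target i then Some (arrow_source i) else None),
    f_op = (\<lambda>i b. if i \<in> colours m n \<and> b = arrow_source i then Some (arrow_target i) else None)\<rparr>"

text \<open>Transport of structure along a bijection \<open>h\<close> with inverse \<open>k\<close>.\<close>

definition relabel :: "('a \<Rightarrow> 'b) \<Rightarrow> ('b \<Rightarrow> 'a) \<Rightarrow> 'a crystal \<Rightarrow> 'b crystal"
  where "relabel h k C = \<lparr>
    carrier = h ` carrier C,
    wt = (\<lambda>x. wt C (k x)),
    e_op = (\<lambda>i x. map_option h (e_op C i (k x))),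
    f_op = (\<lambda>i x. map_option h (f_op C i (k x)))\<rparr>"

text \<open>
  The word \<open>[a\<^sub>1, \<dots>, a\<^sub>r]\<close> stands for \<open>a\<^sub>1 \<otimes> (a\<^sub>2 \<otimes> (\<dots> \<otimes> a\<^sub>r))\<close>; the choice of bracketing is
  immaterial because the tensor product is associative. The power \<open>0\<close> is the
  one-element crystal with zero operators.
\<close>

fun tensor_power :: "nat \<Rightarrow> nat \<Rightarrow> nat \<Rightarrow> letter list crystal"
  where
    "tensor_power m n 0 =
      \<lparr>carrier = {[]}, wt = (\<lambda>_. 0), e_op = (\<lambda>_ _. None), f_op = (\<lambda>_ _. None)\<rparr>"
  | "tensor_power m n (Suc 0) = relabel (\<lambda>a. [a]) hd (letter_crystal m n)"
  | "tensor_power m n (Suc (Suc r)) =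
      relabel (\<lambda>(a, w). a # w) (\<lambda>w. (hd w, tl w))
        (tensor (letter_crystal m n) (tensor_power m n (Suc r)))"

text \<open>One-row tableaux are listed from left to right, one-column tableaux from top to bottom.\<close>

definition semistandard_row :: "nat \<Rightarrow> nat \<Rightarrow> letter list \<Rightarrow> bool"
  where "semistandard_row m n xs \<longleftrightarrow>
    set xs \<subseteq> letters m n \<and> sorted xs \<and>
    (\<forall>i j. i < j \<and> j < length xs \<and> xs ! i = xs ! j \<longrightarrow> xs ! i \<in> B_plus m)"

definition semistandard_column :: "nat \<Rightarrow> nat \<Rightarrow> letter list \<Rightarrow> bool"
  where "semistandard_column m n xs \<longleftrightarrow>
    set xs \<subseteq> letters m n \<and> sorted xs \<and>
    (\<forall>i j. i < j \<and> j < length xs \<and> xs ! i = xs ! j \<longrightarrow> xs ! i \<in> B_minus n)"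

text \<open>
  The operators are those of the tensor power; semistandard columns are stable under them.
\<close>

definition column_crystal :: "nat \<Rightarrow> nat \<Rightarrow> nat \<Rightarrow> letter list crystal"
  where "column_crystal m n r =
    (tensor_power m n r)\<lparr>carrier := {a. length a = r \<and> semistandard_column m n a}\<rparr>"

definition crystal_iso ::
  "nat \<Rightarrow> nat \<Rightarrow> 'a crystal \<Rightarrow> 'b crystal \<Rightarrow> ('a \<Rightarrow> 'b) \<Rightarrow> bool"
  where "crystal_iso m n C D F \<longleftrightarrow>
    bij_betw F (carrier C) (carrier D) \<and>
    (\<forall>x\<in>carrier C. wt D (F x) = wt C x) \<and>
    (\<forall>i\<in>colours m n. \<forall>x\<in>carrier C.
      e_op D i (F x) = map_option F (e_op C i x) \<and>
      f_op D i (F x) = map_option F (f_op C i x))"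

end

theory Submission
  imports Defs "HOL-Library.Multiset"
begin

text \<open>
  A column is a sorted list, so it is determined by the multiset of its entries, and everything
  in sight exchanges a single entry. The operator \<open>f\<^sub>i\<close> exchanges the source \<open>s\<close> of the arrow of
  colour \<open>i\<close> for its target \<open>t\<close>. The map \<open>\<Psi>\<close> exchanges an entry \<open>c\<close> of the column for the
  letter \<open>b\<close> and puts \<open>c\<close> in front. Write \<open>x \<lhd> y\<close> if \<open>x\<close> may stand directly left of \<open>y\<close> in a
  row. Then \<open>c\<close> is the cyclic successor of \<open>b\<close> among the entries: the least entry \<open>x\<close> with
  \<open>b \<lhd> x\<close>, or the least entry of all when there is none. The first alternative is the bumping
  rule of the statement; in the second one \<open>c\<close> is the top entry and \<open>b\<close> belongs below the bottom
  one, so that the word \<open>a\<^sub>1 \<dots> a\<^sub>r b\<close> is merely bracketed differently. The inverse uses the cyclic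
  predecessor. Once \<open>b\<close> has taken the place of its successor \<open>c\<close>, the predecessor of \<open>c\<close> is \<open>b\<close>,
  whence the two maps are mutually inverse (\<open>insert_down_insert_up\<close>, \<open>insert_up_insert_down\<close>).

  That \<open>\<Psi>\<close> commutes with the operators rests on explicit formulas: only letters and columns occur
  as tensor factors, and on a column the operators and the string lengths can be written down (\<open>tensor_power_ops\<close>, \<open>phi_eps_of_ops\<close>): the string lengths are the
  multiplicities of \<open>s\<close> and \<open>t\<close>, up to the exclusion of repeated negative letters.

  Write \<open>\<Psi> (a, b) = (c, d)\<close>. No letter lies strictly between \<open>s\<close> and \<open>t\<close>. So, if \<open>b\<close> is neither
  \<open>s\<close> nor \<open>t\<close>, the exchange of \<open>s\<close> for \<open>t\<close> in \<open>a\<close> leaves the cyclic successor of \<open>b\<close> alone unless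
  that successor was the only \<open>s\<close>, in which case it becomes \<open>t\<close> (\<open>bump_up_after_lower\<close>). This
  matches the tensor product rule: \<open>f\<^sub>i\<close> acts on \<open>c\<close> when the successor moves, and on \<open>d\<close> when
  it stays (\<open>insert_up_commutes_f\<close>). The letters \<open>b = s\<close> and \<open>b = t\<close> require a closer look,
  because they interact with the entries \<open>s\<close> and \<open>t\<close> of \<open>a\<close> in the tensor product rule. For the
  operators \<open>e\<^sub>i\<close> the claim follows, because \<open>e\<^sub>i\<close> and \<open>f\<^sub>i\<close> are partial inverses of each other on
  both tensor products (\<open>adjoint_tensor\<close>).
\<close>

section \<open>Exchanging one entry of a sorted list\<close>

definition exchange :: "int \<Rightarrow> int \<Rightarrow> int list \<Rightarrow> int list"
  where "exchange x y a = insort y (remove1 x a)"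

lemma sorted_exchange: "sorted a \<Longrightarrow> sorted (exchange x y a)"
  by (simp add: exchange_def sorted_insort sorted_remove1)

lemma length_exchange: "x \<in> set a \<Longrightarrow> length (exchange x y a) = length a"
  by (induction a) (auto simp: exchange_def)

text \<open>
  Multiplicities are taken in the integers, so that identities between iterated exchanges become
  linear arithmetic without truncated subtraction.
\<close>

lemma count_exchange:
  "x \<in> set a \<Longrightarrow> int (count (mset (exchange x y a)) z)
    = int (count (mset a) z) - of_bool (z = x) + of_bool (z = y)"
proof -
  assume "x \<in> set a"
  then have "count (mset a) x \<ge> 1" by (simp add: Suc_le_eq)
  then show ?thesis by (auto simp: exchange_def)
qed

lemma mem_set_iff_count: "x \<in> set a \<longleftrightarrow> int (count (mset a) x) > 0"
  by simp

lemma set_exchange_iff: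
  "x \<in> set a \<Longrightarrow> z \<in> set (exchange x y a) \<longleftrightarrow>
    z = y \<or> z \<in> set a \<and> (z = x \<longrightarrow> count (mset a) x > 1)"
  unfolding mem_set_iff_count[of z] count_exchange by auto

text \<open>
  All equations between columns below are reduced by this rule to equations between multiplicities.
\<close>

lemma sorted_eq_if_count_eq:
  assumes "sorted a" "sorted c" "\<And>z. int (count (mset a) z) = int (count (mset c) z)"
  shows "a = c"
proof -
  have "mset a = mset c" using assms(3) by (simp add: multiset_eq_iff)
  then show ?thesis using assms(1,2) by (metis properties_for_sort)
qed

lemma exchange_commute:
  assumes "sorted a" "c \<in> set a" "s \<in> set a" "s \<in> set (exchange c b a)" "c \<in> set (exchange s t a)"
  shows "exchange s t (exchange c b a) = exchange c b (exchange s t a)"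
  using assms by (intro sorted_eq_if_count_eq) (simp_all add: sorted_exchange count_exchange)

lemma exchange_exchange:
  assumes "sorted a" "s \<in> set a"
  shows "exchange t b (exchange s t a) = exchange s b a"
  using assms by (intro sorted_eq_if_count_eq)
    (simp_all add: sorted_exchange count_exchange set_exchange_iff)

lemma exchange_same: "sorted a \<Longrightarrow> s \<in> set a \<Longrightarrow> exchange s s a = a"
  by (intro sorted_eq_if_count_eq) (simp_all add: sorted_exchange count_exchange)

section \<open>Semistandard columns\<close>

definition columns :: "nat \<Rightarrow> nat \<Rightarrow> nat \<Rightarrow> letter list set"
  where "columns m n r = {a. length a = r \<and> semistandard_column m n a}"

text \<open>
  The repetition rule for columns compares entries in two positions; for sorted lists it bounds
  multiplicities. The second form is the one that survives an exchange.
\<close>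

lemma sorted_wrt_strict_below_zero:
  "sorted_wrt (\<lambda>x y :: int. x < y \<or> x = y \<and> x > 0) a \<longleftrightarrow>
    sorted a \<and> (\<forall>x\<le>0. count (mset a) x \<le> 1)"
proof (induction a)
  case (Cons x a)
  have c0: "count (mset a) y = 0 \<longleftrightarrow> y \<notin> set a" for y by (simp add: count_mset_0_iff)
  show ?case
  proof
    assume L: "sorted_wrt (\<lambda>x y. x < y \<or> x = y \<and> x > 0) (x # a)"
    then have "sorted (x # a)" using Cons.IH by auto
    moreover have "count (mset (x # a)) y \<le> 1" if "y \<le> 0" for y
    proof (cases "y = x")
      case True
      then have "y \<notin> set a" using L that by auto
      then show ?thesis using True by (simp add: c0)
    next
      case False
      then show ?thesis using L Cons.IH that by auto
    qed
    ultimately show "sorted (x # a) \<and> (\<forall>x'\<le>0. count (mset (x # a)) x' \<le> 1)" by blast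
  next
    assume R: "sorted (x # a) \<and> (\<forall>x'\<le>0. count (mset (x # a)) x' \<le> 1)"
    have "count (mset a) y \<le> 1" if "y \<le> 0" for y
    proof -
      have "count (mset a) y \<le> count (mset (x # a)) y" by simp
      also have "\<dots> \<le> 1" using R that by blast
      finally show ?thesis .
    qed
    moreover have "x \<notin> set a" if "x \<le> 0"
    proof -
      have "count (mset (x # a)) x \<le> 1" using R that by blast
      then show ?thesis by (simp add: c0)
    qed
    moreover have "\<forall>y\<in>set a. x < y \<or> x = y \<and> x > 0"
      proof
      fix y assume y: "y \<in> set a"
      then have "x \<le> y" using R by simp
      then show "x < y \<or> x = y \<and> x > 0" using calculation(2) y by (metis not_le_imp_less order.order_iff_strict)
    qed
    ultimately show "sorted_wrt (\<lambda>x y. x < y \<or> x = y \<and> x > 0) (x # a)"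
      using R Cons.IH by (simp only: sorted_wrt.simps) blast
  qed
qed simp

lemma letters_iff: "x \<in> letters m n \<longleftrightarrow> - int m \<le> x \<and> x \<le> int n \<and> x \<noteq> 0"
  by (auto simp: letters_def B_plus_def B_minus_def)

lemma semistandard_column_iff:
  "semistandard_column m n a \<longleftrightarrow>
    set a \<subseteq> letters m n \<and> sorted a \<and> (\<forall>x\<le>0. count (mset a) x \<le> 1)"
proof -
  have "semistandard_column m n a \<longleftrightarrow>
    set a \<subseteq> letters m n \<and> sorted_wrt (\<lambda>x y :: int. x < y \<or> x = y \<and> x > 0) a"
  proof (cases "set a \<subseteq> letters m n")
    case True
    then have *: "a ! i \<in> B_minus n \<longleftrightarrow> a ! i > 0" if "i < length a" for i
      using that nth_mem[OF that] by (auto simp: letters_iff B_minus_def subset_iff)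
    have "sorted a \<and> (\<forall>i j. i < j \<and> j < length a \<and> a ! i = a ! j \<longrightarrow> a ! i \<in> B_minus n) \<longleftrightarrow>
      (\<forall>i j. i < j \<longrightarrow> j < length a \<longrightarrow> a ! i \<le> a ! j \<and> (a ! i = a ! j \<longrightarrow> a ! i > 0))"
      unfolding sorted_wrt_iff_nth_less using * order.strict_trans by blast
    also have "\<dots> \<longleftrightarrow> sorted_wrt (\<lambda>x y :: int. x < y \<or> x = y \<and> x > 0) a"
    proof -
      have "x \<le> y \<and> (x = y \<longrightarrow> x > 0) \<longleftrightarrow> x < y \<or> x = y \<and> x > 0" for x y :: int by auto
      then show ?thesis unfolding sorted_wrt_iff_nth_less by simp
    qed
    finally have "sorted a \<and> (\<forall>i j. i < j \<and> j < length a \<and> a ! i = a ! j \<longrightarrow> a ! i \<in> B_minus n) \<longleftrightarrow>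
      sorted_wrt (\<lambda>x y :: int. x < y \<or> x = y \<and> x > 0) a" .
    then show ?thesis using True by (simp add: semistandard_column_def)
  qed (simp add: semistandard_column_def)
  then show ?thesis by (simp add: sorted_wrt_strict_below_zero)
qed

lemma columns_iff:
  "a \<in> columns m n r \<longleftrightarrow> length a = r \<and> set a \<subseteq> letters m n \<and> sorted a \<and>
    (\<forall>x<0. count (mset a) x \<le> 1)"
proof -
  have "count (mset a) 0 \<le> 1" if "set a \<subseteq> letters m n"
  proof -
    have "0 \<notin> set a" using that by (auto simp: letters_iff)
    then have "count (mset a) 0 = 0" by simp
    then show ?thesis by linarith
  qed
  then have "(\<forall>x\<le>0. count (mset a) x \<le> 1) \<longleftrightarrow> (\<forall>x<0. count (mset a) x \<le> 1)"
    if "set a \<subseteq> letters m n"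
    using that by (metis order.order_iff_strict)
  then show ?thesis unfolding columns_def semistandard_column_iff by blast
qed

lemma Cons_in_columnsD:
  assumes "x # w \<in> columns m n (Suc r)"
  shows "w \<in> columns m n r" "x \<in> letters m n" "\<And>y. y \<in> set w \<Longrightarrow> x \<le> y" "x < 0 \<Longrightarrow> x \<notin> set w"
proof -
  have *: "\<And>y. y < 0 \<Longrightarrow> count (mset (x # w)) y \<le> 1" "sorted (x # w)" "set (x # w) \<subseteq> letters m n" "length w = r"
    using assms by (auto simp: columns_iff)
  have "count (mset w) y \<le> 1" if "y < 0" for y
    proof -
    have "count (mset w) y \<le> count (mset (x # w)) y" by simp
    also have "\<dots> \<le> 1" using *(1)[OF that] .
    finally show ?thesis .
  qed
  then show "w \<in> columns m n r" using * by (auto simp: columns_iff)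
  show "x \<in> letters m n" "\<And>y. y \<in> set w \<Longrightarrow> x \<le> y" using * by auto
  show "x < 0 \<Longrightarrow> x \<notin> set w" using *(1)[of x] by simp
qed

lemma exchange_in_columns:
  assumes "a \<in> columns m n r" "x \<in> set a" "y \<in> letters m n" "y < 0 \<Longrightarrow> y \<noteq> x \<Longrightarrow> y \<notin> set a"
  shows "exchange x y a \<in> columns m n r"
proof -
  have "count (mset (exchange x y a)) z \<le> 1" if "z < 0" for z
  proof -
    have "count (mset a) z \<le> 1" using assms that by (simp add: columns_iff)
    moreover have "int (count (mset a) z) = 0" if "z = y" "y \<noteq> x"
      using assms(4) that \<open>z < 0\<close> by simp
    ultimately have "int (count (mset (exchange x y a)) z) \<le> 1"
      unfolding count_exchange[OF assms(2)] by (auto simp: of_bool_def)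
    then show ?thesis by linarith
  qed
  then show ?thesis using assms
    by (auto simp: columns_iff sorted_exchange length_exchange set_exchange_iff)
qed

section \<open>Insertion into a column and its inverse\<close>

text \<open>The relation between horizontal neighbours in a tableau.\<close>

definition precedes :: "int \<Rightarrow> int \<Rightarrow> bool"
  where "precedes x y \<longleftrightarrow> x < y \<or> x = y \<and> x < 0"

text \<open>
  The next two functions give the successor and the predecessor of \<open>b\<close> in \<open>A\<close> for the cyclic order:
  when \<open>b\<close> lies beyond the end of \<open>A\<close> the search starts again from the other end. The second
  case makes one formula out of the two cases of the correspondence.
\<close>

definition bump_up :: "int set \<Rightarrow> int \<Rightarrow> int"
  where "bump_up A b = (if \<exists>x\<in>A. precedes b x then Min {x\<in>A. precedes b x} else Min A)"

definition bump_down :: "int set \<Rightarrow> int \<Rightarrow> int"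
  where "bump_down A b = (if \<exists>x\<in>A. precedes x b then Max {x\<in>A. precedes x b} else Max A)"

text \<open>The two alternatives are exclusive, so the disjunction determines \<open>c\<close>.\<close>

lemma bump_up_eq_iff:
  assumes "finite A" "A \<noteq> {}"
  shows "bump_up A b = c \<longleftrightarrow> c \<in> A \<and>
    (precedes b c \<and> (\<forall>x\<in>A. precedes b x \<longrightarrow> c \<le> x) \<or>
     (\<forall>x\<in>A. \<not> precedes b x \<and> c \<le> x))"
proof (cases "\<exists>x\<in>A. precedes b x")
  case True
  then have "bump_up A b = c \<longleftrightarrow> c \<in> {x\<in>A. precedes b x} \<and> (\<forall>x\<in>{x\<in>A. precedes b x}. c \<le> x)"
    using assms unfolding bump_up_def by (simp only: if_True) (rule Min_eq_iff, auto)
  then show ?thesis using True by auto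
next
  case False
  then have "bump_up A b = c \<longleftrightarrow> c \<in> A \<and> (\<forall>x\<in>A. c \<le> x)"
    using assms unfolding bump_up_def by (simp only: if_False) (rule Min_eq_iff, auto)
  then show ?thesis using False by auto
qed

lemma bump_down_eq_iff:
  assumes "finite A" "A \<noteq> {}"
  shows "bump_down A b = c \<longleftrightarrow> c \<in> A \<and>
    (precedes c b \<and> (\<forall>x\<in>A. precedes x b \<longrightarrow> x \<le> c) \<or>
     (\<forall>x\<in>A. \<not> precedes x b \<and> x \<le> c))"
proof (cases "\<exists>x\<in>A. precedes x b")
  case True
  then have "bump_down A b = c \<longleftrightarrow> c \<in> {x\<in>A. precedes x b} \<and> (\<forall>x\<in>{x\<in>A. precedes x b}. x \<le> c)"
    using assms unfolding bump_down_def by (simp only: if_True) (rule Max_eq_iff, auto)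
  then show ?thesis using True by auto
next
  case False
  then have "bump_down A b = c \<longleftrightarrow> c \<in> A \<and> (\<forall>x\<in>A. x \<le> c)"
    using assms unfolding bump_down_def by (simp only: if_False) (rule Max_eq_iff, auto)
  then show ?thesis using False by auto
qed

lemma column_multiplicity:
  assumes "a \<in> columns m n r" "x < 0"
  shows "\<not> count (mset a) x > 1"
proof -
  have "count (mset a) x \<le> 1" using assms by (simp add: columns_iff)
  then show ?thesis by simp
qed

text \<open>
  The exchange yields a column again: a negative \<open>b\<close> that already occurs in \<open>a\<close> precedes itself,
  so it is its own successor and the column does not change. For the last claim, let \<open>x\<close> be
  an entry of the new column other than \<open>b\<close>. If \<open>b \<lhd> c\<close> and \<open>x \<lhd> c\<close>, then \<open>b < x\<close> would give
  \<open>c \<le> x\<close> by minimality and hence a repeated negative letter \<open>x = c\<close>. If \<open>b\<close> has no successor in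
  the strict sense, then \<open>c\<close> is the minimum of \<open>a\<close>, the same argument leaves no entry in front of
  \<open>c\<close>, and the search from the other end finds the maximum \<open>b\<close>.
\<close>

lemma bump_up_facts:
  assumes "a \<in> columns m n r" "r \<ge> 1" "b \<in> letters m n"
  defines "c \<equiv> bump_up (set a) b"
  shows "c \<in> set a" "c \<in> letters m n" "exchange c b a \<in> columns m n r"
    "bump_down (set (exchange c b a)) c = b"
proof -
  have ne: "set a \<noteq> {}" using assms by (auto simp: columns_iff)
  have c: "c \<in> set a \<and> (precedes b c \<and> (\<forall>x\<in>set a. precedes b x \<longrightarrow> c \<le> x) \<or>
     (\<forall>x\<in>set a. \<not> precedes b x \<and> c \<le> x))"
    using bump_up_eq_iff[OF finite_set ne, of b c] by (simp add: c_def)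
  then show mem: "c \<in> set a" by blast
  then show "c \<in> letters m n" using assms by (auto simp: columns_iff)
  have "b < 0 \<Longrightarrow> b \<noteq> c \<Longrightarrow> b \<notin> set a" 
    using c by (force simp: precedes_def)
  then show ex: "exchange c b a \<in> columns m n r"
    using assms mem by (intro exchange_in_columns)
  have ne': "set (exchange c b a) \<noteq> {}" by (simp add: exchange_def set_insort_key)
  have mem': "x \<in> set (exchange c b a) \<longleftrightarrow> x = b \<or> x \<in> set a \<and> (x = c \<longrightarrow> count (mset a) c > 1)" for x
    by (rule set_exchange_iff[OF mem])
  have one: "c < 0 \<Longrightarrow> \<not> count (mset a) c > 1" by (rule column_multiplicity[OF assms(1)])
  have "b \<in> set (exchange c b a)" using mem' by blast
  moreover have "x \<le> b" if "precedes b c" "x \<in> set (exchange c b a)" "precedes x c" for x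
  proof (cases "x = b")
    case False
    then have x: "x \<in> set a" "x = c \<Longrightarrow> count (mset a) c > 1" using mem' that by blast+
    have "precedes b x \<Longrightarrow> c \<le> x" using c x that by blast
    then show ?thesis using x one that unfolding precedes_def by linarith
  qed simp
  moreover have "\<not> precedes x c \<and> x \<le> b" if "\<not> precedes b c" "x \<in> set (exchange c b a)" for x
  proof (cases "x = b")
    case True
    then show ?thesis using that by simp
  next
    case False
    then have x: "x \<in> set a" "x = c \<Longrightarrow> count (mset a) c > 1" using mem' that by blast+
    have "\<not> precedes b x \<and> c \<le> x" using c x that by blast
    then show ?thesis using x one that by (auto simp: precedes_def)
  qed
  ultimately show "bump_down (set (exchange c b a)) c = b"
    unfolding bump_down_eq_iff[OF finite_set ne'] by blast
qed

lemma bump_down_facts: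
  assumes "a \<in> columns m n r" "r \<ge> 1" "b \<in> letters m n"
  defines "c \<equiv> bump_down (set a) b"
  shows "c \<in> set a" "c \<in> letters m n" "exchange c b a \<in> columns m n r"
    "bump_up (set (exchange c b a)) c = b"
proof -
  have ne: "set a \<noteq> {}" using assms by (auto simp: columns_iff)
  have c: "c \<in> set a \<and> (precedes c b \<and> (\<forall>x\<in>set a. precedes x b \<longrightarrow> x \<le> c) \<or>
     (\<forall>x\<in>set a. \<not> precedes x b \<and> x \<le> c))"
    using bump_down_eq_iff[OF finite_set ne, of b c] by (simp add: c_def)
  then show mem: "c \<in> set a" by blast
  then show "c \<in> letters m n" using assms by (auto simp: columns_iff)
  have "b < 0 \<Longrightarrow> b \<noteq> c \<Longrightarrow> b \<notin> set a" 
    using c by (force simp: precedes_def)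
  then show ex: "exchange c b a \<in> columns m n r"
    using assms mem by (intro exchange_in_columns)
  have ne': "set (exchange c b a) \<noteq> {}" by (simp add: exchange_def set_insort_key)
  have mem': "x \<in> set (exchange c b a) \<longleftrightarrow> x = b \<or> x \<in> set a \<and> (x = c \<longrightarrow> count (mset a) c > 1)" for x
    by (rule set_exchange_iff[OF mem])
  have one: "c < 0 \<Longrightarrow> \<not> count (mset a) c > 1" by (rule column_multiplicity[OF assms(1)])
  have "b \<in> set (exchange c b a)" using mem' by blast
  moreover have "b \<le> x" if "precedes c b" "x \<in> set (exchange c b a)" "precedes c x" for x
  proof (cases "x = b")
    case False
    then have x: "x \<in> set a" "x = c \<Longrightarrow> count (mset a) c > 1" using mem' that by blast+
    have "precedes x b \<Longrightarrow> x \<le> c" using c x that by blast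
    then show ?thesis using x one that unfolding precedes_def by linarith
  qed simp
  moreover have "\<not> precedes c x \<and> b \<le> x" if "\<not> precedes c b" "x \<in> set (exchange c b a)" for x
  proof (cases "x = b")
    case True
    then show ?thesis using that by simp
  next
    case False
    then have x: "x \<in> set a" "x = c \<Longrightarrow> count (mset a) c > 1" using mem' that by blast+
    have "\<not> precedes x b \<and> x \<le> c" using c x that by blast
    then show ?thesis using x one that by (auto simp: precedes_def)
  qed
  ultimately show "bump_up (set (exchange c b a)) c = b"
    unfolding bump_up_eq_iff[OF finite_set ne'] by blast
qed

text \<open>These are the maps \<open>\<Psi>\<close> and \<open>\<Psi>'\<close> of the theorem.\<close>

definition insert_up :: "int list \<times> int \<Rightarrow> int \<times> int list"
  where "insert_up = (\<lambda>(a, b). let c = bump_up (set a) b in (c, exchange c b a))"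

definition insert_down :: "int \<times> int list \<Rightarrow> int list \<times> int"
  where "insert_down = (\<lambda>(b, a). let c = bump_down (set a) b in (exchange c b a, c))"

lemma insert_down_insert_up:
  assumes "a \<in> columns m n r" "r \<ge> 1" "b \<in> letters m n"
  shows "insert_down (insert_up (a, b)) = (a, b)"
proof -
  have "sorted a" using assms by (simp add: columns_iff)
  then show ?thesis using bump_up_facts[OF assms]
    by (simp add: insert_up_def insert_down_def Let_def exchange_exchange exchange_same)
qed

lemma insert_up_insert_down:
  assumes "a \<in> columns m n r" "r \<ge> 1" "b \<in> letters m n"
  shows "insert_up (insert_down (b, a)) = (b, a)"
proof -
  have "sorted a" using assms by (simp add: columns_iff)
  then show ?thesis using bump_down_facts[OF assms]
    by (simp add: insert_up_def insert_down_def Let_def exchange_exchange exchange_same)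
qed

section \<open>Operators and string lengths on letters and columns\<close>

lemma iterate_Suc:
  "iterate g (Suc k) x = (case g x of None \<Rightarrow> None | Some y \<Rightarrow> iterate g k y)"
proof -
  have "((\<lambda>y. Option.bind y g) ^^ k) None = None" for k by (induction k) auto
  then show ?thesis unfolding iterate_def funpow_Suc_right by (auto split: option.split)
qed

text \<open>
  A string length is determined by its value at the end of a string and its increment along the
  string. Such a function \<open>p\<close> also bounds the number of iterations, without which the maximum over
  an infinite set would be unspecified.
\<close>

lemma Max_iterate_eq:
  assumes "x \<in> S"
    and end_: "\<And>x. x \<in> S \<Longrightarrow> g x = None \<Longrightarrow> p x = 0"
    and step: "\<And>x y. x \<in> S \<Longrightarrow> g x = Some y \<Longrightarrow> y \<in> S \<and> p x = Suc (p y)"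
  shows "Max {k. iterate g k x \<noteq> None} = p x"
proof -
  have "iterate g k x \<noteq> None \<longleftrightarrow> k \<le> p x" for k
    using \<open>x \<in> S\<close>
  proof (induction k arbitrary: x)
    case 0
    then show ?case by (simp add: iterate_def)
  next
    case (Suc k)
    show ?case
    proof (cases "g x")
      case None
      then show ?thesis using end_[OF Suc.prems] by (simp add: iterate_Suc)
    next
      case (Some y)
      then show ?thesis using step[OF Suc.prems Some] Suc.IH[of y] by (simp add: iterate_Suc)
    qed
  qed
  then have "{k. iterate g k x \<noteq> None} = {..p x}" by auto
  then show ?thesis by (simp add: Max_eq_iff)
qed

lemma arrow_facts:
  assumes "i \<in> colours m n"
  shows "arrow_source i \<in> letters m n" "arrow_target i \<in> letters m n"
    "arrow_source i < arrow_target i"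
    "arrow_source i < 0 \<longleftrightarrow> i \<le> 0" "arrow_target i < 0 \<longleftrightarrow> i < 0"
    "x \<in> letters m n \<Longrightarrow> x \<le> arrow_source i \<or> arrow_target i \<le> x"
  using assms by (auto simp: arrow_source_def arrow_target_def colours_def letters_iff)

lemma letter_ops:
  assumes "i \<in> colours m n"
  shows "f_op (letter_crystal m n) i b = (if b = arrow_source i then Some (arrow_target i) else None)"
    "e_op (letter_crystal m n) i b = (if b = arrow_target i then Some (arrow_source i) else None)"
    "phi (letter_crystal m n) i b = of_bool (b = arrow_source i)"
    "eps (letter_crystal m n) i b = of_bool (b = arrow_target i)"
    "wt (letter_crystal m n) b = Poly_Mapping.single b 1"
    "carrier (letter_crystal m n) = letters m n"
proof -
  show f: "f_op (letter_crystal m n) i b = (if b = arrow_source i then Some (arrow_target i) else None)"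
    and e: "e_op (letter_crystal m n) i b = (if b = arrow_target i then Some (arrow_source i) else None)"
    for b using assms by (simp_all add: letter_crystal_def)
  have "arrow_source i \<noteq> arrow_target i" using arrow_facts[OF assms] by simp
  then show "phi (letter_crystal m n) i b = of_bool (b = arrow_source i)"
    "eps (letter_crystal m n) i b = of_bool (b = arrow_target i)"
    unfolding phi_def eps_def
    by (intro Max_iterate_eq[where S = UNIV]; auto simp: f e split: if_splits)+
qed (simp_all add: letter_crystal_def)

text \<open>
  The side conditions say that the exchange must not create a second copy of a negative letter:
  the target is negative for \<open>i < 0\<close>, the source for \<open>i \<le> 0\<close>.
\<close>

definition lowerable :: "colour \<Rightarrow> letter list \<Rightarrow> bool"
  where "lowerable i a \<longleftrightarrow> arrow_source i \<in> set a \<and> (i < 0 \<longrightarrow> arrow_target i \<notin> set a)"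

definition raisable :: "colour \<Rightarrow> letter list \<Rightarrow> bool"
  where "raisable i a \<longleftrightarrow> arrow_target i \<in> set a \<and> (i \<le> 0 \<longrightarrow> arrow_source i \<notin> set a)"

definition lower :: "colour \<Rightarrow> letter list \<Rightarrow> letter list option"
  where "lower i a = (if lowerable i a then Some (exchange (arrow_source i) (arrow_target i) a) else None)"

definition raise :: "colour \<Rightarrow> letter list \<Rightarrow> letter list option"
  where "raise i a = (if raisable i a then Some (exchange (arrow_target i) (arrow_source i) a) else None)"

definition col_phi :: "colour \<Rightarrow> letter list \<Rightarrow> nat"
  where "col_phi i a = (if i \<le> 0 then of_bool (lowerable i a) else count (mset a) (arrow_source i))"

definition col_eps :: "colour \<Rightarrow> letter list \<Rightarrow> nat"
  where "col_eps i a = (if i \<le> 0 then of_bool (raisable i a) else count (mset a) (arrow_target i))"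

lemma lower_facts:
  assumes "i \<in> colours m n" "a \<in> columns m n r" "lower i a = Some c"
  shows "c \<in> columns m n r" "raise i c = Some a" "col_phi i a = Suc (col_phi i c)"
    "col_eps i c = Suc (col_eps i a)"
proof -
  note A = arrow_facts[OF assms(1)]
  let ?s = "arrow_source i" and ?t = "arrow_target i"
  have c: "c = exchange ?s ?t a" and low: "lowerable i a" and s: "?s \<in> set a"
    using assms(3) by (auto simp: lower_def lowerable_def split: if_splits)
  have srt: "sorted a" using assms by (simp add: columns_iff)
  show "c \<in> columns m n r" unfolding c using low A assms(2)
    by (intro exchange_in_columns) (auto simp: lowerable_def)
  have cnt: "int (count (mset c) z) = int (count (mset a) z) - of_bool (z = ?s) + of_bool (z = ?t)" for z
    unfolding c by (rule count_exchange[OF s])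
  have mem: "z \<in> set c \<longleftrightarrow> z = ?t \<or> z \<in> set a \<and> (z = ?s \<longrightarrow> count (mset a) ?s > 1)" for z
    unfolding c by (rule set_exchange_iff[OF s])
  have one: "?s < 0 \<Longrightarrow> \<not> count (mset a) ?s > 1" by (rule column_multiplicity[OF assms(2)])
  have r: "raisable i c" using mem one A low by (auto simp: raisable_def lowerable_def)
  then show "raise i c = Some a"
    using s srt by (simp add: raise_def c exchange_exchange exchange_same)
  have s': "count (mset a) ?s > 0" using s by simp
  show "col_phi i a = Suc (col_phi i c)"
    using low cnt[of ?s] A mem one s' by (auto simp: col_phi_def lowerable_def)
  show "col_eps i c = Suc (col_eps i a)"
    using low r cnt[of ?t] A s' s by (auto simp: col_eps_def raisable_def)
qed

lemma raise_facts:
  assumes "i \<in> colours m n" "a \<in> columns m n r" "raise i a = Some c"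
  shows "c \<in> columns m n r" "lower i c = Some a" 
proof -
  note A = arrow_facts[OF assms(1)]
  let ?s = "arrow_source i" and ?t = "arrow_target i"
  have c: "c = exchange ?t ?s a" and low: "raisable i a" and s: "?t \<in> set a"
    using assms(3) by (auto simp: raise_def raisable_def split: if_splits)
  have srt: "sorted a" using assms by (simp add: columns_iff)
  show "c \<in> columns m n r" unfolding c using low A assms(2)
    by (intro exchange_in_columns) (auto simp: raisable_def)
  have mem: "z \<in> set c \<longleftrightarrow> z = ?s \<or> z \<in> set a \<and> (z = ?t \<longrightarrow> count (mset a) ?t > 1)" for z
    unfolding c by (rule set_exchange_iff[OF s])
  have one: "?t < 0 \<Longrightarrow> \<not> count (mset a) ?t > 1" by (rule column_multiplicity[OF assms(2)])
  have r: "lowerable i c" using mem one A low by (auto simp: raisable_def lowerable_def)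
  then show "lower i c = Some a"
    using s srt by (simp add: lower_def c exchange_exchange exchange_same)
qed

text \<open>
  The hypotheses concern a single length \<open>r\<close>, because in the induction on the length of a column
  the string lengths of the tail are needed before the operators on the whole column.
\<close>

lemma phi_eps_of_ops:
  assumes "i \<in> colours m n" "a \<in> columns m n r"
    and f: "\<And>a. a \<in> columns m n r \<Longrightarrow> f_op C i a = lower i a"
    and e: "\<And>a. a \<in> columns m n r \<Longrightarrow> e_op C i a = raise i a"
  shows "phi C i a = col_phi i a" "eps C i a = col_eps i a"
proof -
  show "phi C i a = col_phi i a" unfolding phi_def
  proof (rule Max_iterate_eq[where S = "columns m n r"])
    show "col_phi i x = 0" if "x \<in> columns m n r" "f_op C i x = None" for x
      using that by (auto simp: f lower_def col_phi_def lowerable_def split: if_splits)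
    show "y \<in> columns m n r \<and> col_phi i x = Suc (col_phi i y)"
      if "x \<in> columns m n r" "f_op C i x = Some y" for x y
      using lower_facts[OF assms(1) that(1)] that by (simp add: f)
  qed (fact assms)
  show "eps C i a = col_eps i a" unfolding eps_def
  proof (rule Max_iterate_eq[where S = "columns m n r"])
    show "col_eps i x = 0" if "x \<in> columns m n r" "e_op C i x = None" for x
      using that by (auto simp: e raise_def col_eps_def raisable_def split: if_splits)
    show "y \<in> columns m n r \<and> col_eps i x = Suc (col_eps i y)"
      if "x \<in> columns m n r" "e_op C i x = Some y" for x y
      using raise_facts[OF assms(1) that(1)] lower_facts(4)[OF assms(1)] that by (metis e)
  qed (fact assms)
qed

text \<open>
  The tensor product rule changes a word \<open>x # w\<close> either at its head or inside its tail. The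
  following two lemmas say when the result is the sorted list.
\<close>

lemma exchange_Cons_head:
  "sorted (x # w) \<Longrightarrow> (\<And>z. z \<in> set w \<Longrightarrow> y \<le> z) \<Longrightarrow> exchange x y (x # w) = y # w"
  by (cases w) (auto simp: exchange_def)

lemma exchange_Cons_tail:
  assumes "sorted (x # w)" "z \<in> set w" "x \<le> y"
  shows "exchange z y (x # w) = x # exchange z y w"
proof (rule sorted_eq_if_count_eq)
  have "sorted (exchange z y w)" using assms by (simp add: sorted_exchange)
  moreover have "x \<le> u" if "u \<in> set (exchange z y w)" for u
    using that assms set_exchange_iff[OF assms(2)] by auto
  ultimately show "sorted (x # exchange z y w)" by simp
  show "int (count (mset (exchange z y (x # w))) u) = int (count (mset (x # exchange z y w)) u)" for u
    using count_exchange[of z "x # w" y u] count_exchange[OF assms(2), of y u] assms(2) by simp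
qed (use assms in \<open>simp add: sorted_exchange\<close>)

text \<open>
  For \<open>i < 0\<close> the pair \<open>s, t\<close> in a column cancels, since the head \<open>s\<close> has \<open>\<phi>\<^sub>i = 1\<close> and the tail has
  \<open>\<epsilon>\<^sub>i = 1\<close>. For \<open>i > 0\<close> the factors are compared in the opposite order, all copies of \<open>s\<close> stand
  above all copies of \<open>t\<close>, and nothing cancels: \<open>f\<^sub>i\<close> changes the last \<open>s\<close> and \<open>e\<^sub>i\<close> the first \<open>t\<close>.
  For \<open>i = 0\<close> the operators act on the topmost entry that is \<open>-1\<close> or \<open>1\<close>, which is \<open>-1\<close> if this
  letter occurs. In each case the outcome is sorted again, hence the exchange of \<open>s\<close> and \<open>t\<close>.
\<close>

lemma tensor_power_ops:
  assumes "i \<in> colours m n" "a \<in> columns m n r"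
  shows "f_op (tensor_power m n r) i a = lower i a \<and> e_op (tensor_power m n r) i a = raise i a"
  using assms
proof (induction m n r arbitrary: a rule: tensor_power.induct)
  case (1 m n)
  then show ?case
    by (simp add: columns_iff lower_def raise_def lowerable_def raisable_def)
next
  case (2 m n)
  then obtain x where "a = [x]" by (auto simp: columns_iff length_Suc_conv)
  then show ?case using 2 arrow_facts[OF 2(1)]
    by (auto simp: relabel_def letter_ops lower_def raise_def lowerable_def raisable_def exchange_def)
next
  case (3 m n r)
  note i = \<open>i \<in> colours m n\<close>
  note A = arrow_facts[OF i]
  let ?s = "arrow_source i" and ?t = "arrow_target i" and ?T = "tensor_power m n (Suc r)"
  obtain x w where a: "a = x # w" using 3(3) by (cases a) (auto simp: columns_iff)
  note xw = Cons_in_columnsD[OF 3(3)[unfolded a]]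
  have srt: "sorted (x # w)" using 3(3) a by (simp add: columns_iff)
  have IH: "f_op ?T i w = lower i w" "e_op ?T i w = raise i w" if "w \<in> columns m n (Suc r)" for w
    using 3(1)[OF i that] by auto
  note pe = phi_eps_of_ops[OF i xw(1), of ?T, OF IH]
  (* The word produced by the rule is the sorted one, at each position where the rule acts:
     F1 and E1 treat the head, F2 and E2 the tail. *)
  have ge: "?t \<le> z" if "z \<in> set w" "?s \<notin> set w" "x = ?s" for z
    using xw(3)[OF that(1)] that A(6)[of z] xw(1) by (auto simp: columns_iff)
  have F1: "exchange ?s ?t (?s # w) = ?t # w" if "x = ?s" "?s \<notin> set w"
    using exchange_Cons_head[of ?s w ?t] srt that ge by blast
  have F2: "exchange ?s ?t (x # w) = x # exchange ?s ?t w" if "?s \<in> set w"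
    using exchange_Cons_tail[OF srt that, of ?t] xw(3)[OF that] A by simp
  have F2': "exchange ?s ?t (?s # w) = ?s # exchange ?s ?t w" if "x = ?s" "?s \<in> set w"
    using F2[OF that(2)] that(1) by simp
  have E2': "exchange ?t ?s (?s # w) = ?s # exchange ?t ?s w" if "x = ?s" "?t \<in> set w"
    using exchange_Cons_tail[of ?s w ?t ?s] srt that by simp
  have absent: "z \<notin> set w \<Longrightarrow> count (mset w) z = 0" for z by simp
  have E1: "exchange ?t ?s (?t # w) = ?s # w" if "x = ?t"
    using exchange_Cons_head[of ?t w ?s] srt that xw(3) A by force
  have E2: "exchange ?t ?s (x # w) = x # exchange ?t ?s w" if "?t \<in> set w" "x \<noteq> ?t"
    using exchange_Cons_tail[OF srt that(1), of ?s] xw(2) xw(3)[OF that(1)] that A(6)[of x] A by simp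
  have ts: "x = ?t \<Longrightarrow> ?s \<notin> set w" using xw(3) A by force
  have ss: "x = ?s \<Longrightarrow> i \<le> 0 \<Longrightarrow> ?s \<notin> set w" and tt: "x = ?t \<Longrightarrow> i < 0 \<Longrightarrow> ?t \<notin> set w"
    using xw(4) A by auto
  have st: "?s \<noteq> ?t" using A by simp
  consider "i < 0" | "i = 0" | "i > 0" by linarith
  then show ?case
  proof cases
    case 1
    then show ?thesis using st ts ss tt 
      by (auto simp: a relabel_def tensor_def Let_def letter_ops[OF i] pe IH[OF xw(1)]
        col_phi_def col_eps_def lower_def raise_def lowerable_def raisable_def F1 F2 F2' E1 E2 E2' absent)
  next
    case 2
    have s: "arrow_source 0 = -1" "arrow_target 0 = 1" by (simp_all add: arrow_source_def arrow_target_def)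
    have h: "h0 (Poly_Mapping.single x 1) = of_bool (x = -1 \<or> x = 1)"
      by (auto simp: h0_def lookup_single when_def)
    show ?thesis using ts ss tt h unfolding 2 s
      by (auto simp: a relabel_def tensor_def Let_def letter_ops[OF i, unfolded 2 s]
        IH[OF xw(1), unfolded 2] lower_def raise_def lowerable_def raisable_def s
        F1[unfolded 2 s] F2[unfolded 2 s] E1[unfolded 2 s] E2[unfolded 2 s])
  next
    case 3
    then show ?thesis using st ts ss tt 
      by (auto simp: a relabel_def tensor_def Let_def letter_ops[OF i] pe IH[OF xw(1)]
        col_phi_def col_eps_def lower_def raise_def lowerable_def raisable_def F1 F2 F2' E1 E2 E2' absent)
  qed
qed

lemma lookup_wt_tensor_power:
  "length a = r \<Longrightarrow> Poly_Mapping.lookup (wt (tensor_power m n r) a) x = int (count (mset a) x)"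
proof (induction m n r arbitrary: a rule: tensor_power.induct)
  case (2 m n)
  then show ?case
    by (auto simp: length_Suc_conv relabel_def letter_crystal_def lookup_single when_def)
next
  case (3 m n r)
  then obtain y w where "a = y # w" "length w = Suc r" by (auto simp: length_Suc_conv)
  then show ?case using 3(1)
    by (auto simp: relabel_def tensor_def letter_crystal_def lookup_single lookup_add when_def)
qed simp

lemma column_crystal_simps:
  "carrier (column_crystal m n r) = columns m n r"
  "wt (column_crystal m n r) = wt (tensor_power m n r)"
  by (simp_all add: column_crystal_def columns_def)

lemma column_ops:
  assumes "i \<in> colours m n" "a \<in> columns m n r"
  shows "f_op (column_crystal m n r) i a = lower i a"
    "e_op (column_crystal m n r) i a = raise i a"
    "phi (column_crystal m n r) i a = col_phi i a"
    "eps (column_crystal m n r) i a = col_eps i a"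
proof -
  have fe: "f_op (column_crystal m n r) i a = lower i a" "e_op (column_crystal m n r) i a = raise i a"
    if "a \<in> columns m n r" for a
    using tensor_power_ops[OF assms(1) that] by (simp_all add: column_crystal_def)
  show "f_op (column_crystal m n r) i a = lower i a" "e_op (column_crystal m n r) i a = raise i a"
    by (fact fe[OF assms(2)])+
  show "phi (column_crystal m n r) i a = col_phi i a"
    "eps (column_crystal m n r) i a = col_eps i a"
    by (rule phi_eps_of_ops[OF assms]; fact fe)+
qed

lemma h0_column:
  "a \<in> columns m n r \<Longrightarrow>
    h0 (wt (column_crystal m n r) a) = int (count (mset a) (-1)) + int (count (mset a) 1)"
  by (simp add: h0_def column_crystal_simps lookup_wt_tensor_power columns_iff)

section \<open>The operators as partial inverses\<close>

definition adjoint_at :: "'a crystal \<Rightarrow> colour \<Rightarrow> bool"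
  where "adjoint_at C i \<longleftrightarrow> (\<forall>x\<in>carrier C. \<forall>y.
    (f_op C i x = Some y \<longrightarrow> y \<in> carrier C \<and> e_op C i y = Some x) \<and>
    (e_op C i x = Some y \<longrightarrow> y \<in> carrier C \<and> f_op C i y = Some x))"

text \<open>
  Besides adjointness, what the tensor product rule reads off a factor must change along an arrow
  in the expected way. The value of \<open>h\<^sub>0\<close> matters for the colour \<open>0\<close> only, where it decides which
  factor is acted on.
\<close>

definition normal_at :: "'a crystal \<Rightarrow> colour \<Rightarrow> bool"
  where "normal_at C i \<longleftrightarrow> adjoint_at C i \<and> (\<forall>x\<in>carrier C. \<forall>y. f_op C i x = Some y \<longrightarrow>
    phi C i x = Suc (phi C i y) \<and> eps C i y = Suc (eps C i x) \<and>
    (i = 0 \<longrightarrow> h0 (wt C y) = h0 (wt C x)))"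

text \<open>
  The strict inequality in the rule for \<open>f\<^sub>i\<close> turns into the weak one in the rule for \<open>e\<^sub>i\<close> once the
  string length has dropped by one, so \<open>e\<^sub>i\<close> acts on the factor that \<open>f\<^sub>i\<close> has changed.
\<close>

lemma adjoint_tensor:
  assumes "normal_at C i" "normal_at D i"
  shows "adjoint_at (tensor C D) i"
proof -
  have C: "y \<in> carrier C" "e_op C i y = Some x" "phi C i x = Suc (phi C i y)" "eps C i y = Suc (eps C i x)"
    "i = 0 \<Longrightarrow> h0 (wt C y) = h0 (wt C x)"
    if "x \<in> carrier C" "f_op C i x = Some y" for x y
    using assms(1) that unfolding normal_at_def adjoint_at_def by blast+
  have C': "y \<in> carrier C" "f_op C i y = Some x"
    if "x \<in> carrier C" "e_op C i x = Some y" for x y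
    using assms(1) that unfolding normal_at_def adjoint_at_def by blast+
  have D: "y \<in> carrier D" "e_op D i y = Some x" "phi D i x = Suc (phi D i y)" "eps D i y = Suc (eps D i x)"
    if "x \<in> carrier D" "f_op D i x = Some y" for x y
    using assms(2) that unfolding normal_at_def adjoint_at_def by blast+
  have D': "y \<in> carrier D" "f_op D i y = Some x"
    if "x \<in> carrier D" "e_op D i x = Some y" for x y
    using assms(2) that unfolding normal_at_def adjoint_at_def by blast+
  have car: "carrier (tensor C D) = carrier C \<times> carrier D" by (simp add: tensor_def)
  define P where "P x y \<longleftrightarrow> (if i < 0 then phi C i x > eps D i y
    else if i > 0 then phi D i y \<le> eps C i x else h0 (wt C x) > 0)" for x y
  define Q where "Q x y \<longleftrightarrow> (if i < 0 then phi C i x \<ge> eps D i y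
    else if i > 0 then phi D i y < eps C i x else h0 (wt C x) > 0)" for x y
  have f: "f_op (tensor C D) i (x, y) = (if P x y then map_option (\<lambda>x'. (x', y)) (f_op C i x)
      else map_option (\<lambda>y'. (x, y')) (f_op D i y))" for x y
    by (simp add: tensor_def Let_def P_def)
  have e: "e_op (tensor C D) i (x, y) = (if Q x y then map_option (\<lambda>x'. (x', y)) (e_op C i x)
      else map_option (\<lambda>y'. (x, y')) (e_op D i y))" for x y
    by (simp add: tensor_def Let_def Q_def)
  have PQ1: "P x y \<longleftrightarrow> Q x' y" if "x \<in> carrier C" "f_op C i x = Some x'" for x x' y
    using C[OF that] by (auto simp: P_def Q_def)
  have PQ2: "P x y \<longleftrightarrow> Q x y'" if "y \<in> carrier D" "f_op D i y = Some y'" for x y y'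
    using D[OF that] by (auto simp: P_def Q_def)
  have "u \<in> carrier C \<times> carrier D \<and> e_op (tensor C D) i u = Some (x, y)"
    if x: "x \<in> carrier C" and y: "y \<in> carrier D" and u: "f_op (tensor C D) i (x, y) = Some u" for x y u
  proof (cases "P x y")
    case True
    then obtain x' where x': "u = (x', y)" "f_op C i x = Some x'" using u by (auto simp: f)
    then show ?thesis using C[OF x x'(2)] y PQ1[OF x x'(2)] True by (simp add: e)
  next
    case False
    then obtain y' where y': "u = (x, y')" "f_op D i y = Some y'" using u by (auto simp: f)
    then show ?thesis using D[OF y y'(2)] x PQ2[OF y y'(2)] False by (simp add: e)
  qed
  moreover have "u \<in> carrier C \<times> carrier D \<and> f_op (tensor C D) i u = Some (x, y)"
    if x: "x \<in> carrier C" and y: "y \<in> carrier D" and u: "e_op (tensor C D) i (x, y) = Some u" for x y u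
  proof (cases "Q x y")
    case True
    then obtain x' where x': "u = (x', y)" "e_op C i x = Some x'" using u by (auto simp: e)
    then show ?thesis using C'[OF x x'(2)] y PQ1[OF C'[OF x x'(2)]] True by (simp add: f)
  next
    case False
    then obtain y' where y': "u = (x, y')" "e_op D i y = Some y'" using u by (auto simp: e)
    then show ?thesis using D'[OF y y'(2)] x PQ2[OF D'[OF y y'(2)]] False by (simp add: f)
  qed
  ultimately show ?thesis unfolding adjoint_at_def car by (intro ballI allI) (elim SigmaE, blast)
qed

lemma normal_letter:
  assumes "i \<in> colours m n"
  shows "normal_at (letter_crystal m n) i"
  using arrow_facts[OF assms]
  by (auto simp: normal_at_def adjoint_at_def letter_ops[OF assms] h0_def lookup_single when_def
      arrow_source_def arrow_target_def)

lemma normal_column: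
  assumes i: "i \<in> colours m n"
  shows "normal_at (column_crystal m n r) i"
proof -
  have h: "h0 (wt (column_crystal m n r) y) = h0 (wt (column_crystal m n r) x)"
    if "x \<in> columns m n r" "lower i x = Some y" "i = 0" for x y
  proof -
    have "y = exchange (-1) 1 x" "-1 \<in> set x"
      using that by (auto simp: lower_def lowerable_def arrow_source_def arrow_target_def split: if_splits)
    then show ?thesis using lower_facts(1)[OF i that(1,2)] that(1)
      by (simp add: h0_column count_exchange)
  qed
  show ?thesis
    unfolding normal_at_def adjoint_at_def column_crystal_simps(1)
  proof (intro conjI ballI allI impI)
    fix x y assume x: "x \<in> columns m n r"
    {
      assume "f_op (column_crystal m n r) i x = Some y"
      then have l: "lower i x = Some y" using x by (simp add: column_ops[OF i])
      note y = lower_facts[OF i x l]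
      show "y \<in> columns m n r" by (fact y)
      show "e_op (column_crystal m n r) i y = Some x" using y by (simp add: column_ops[OF i y(1)])
      show "phi (column_crystal m n r) i x = Suc (phi (column_crystal m n r) i y)"
        "eps (column_crystal m n r) i y = Suc (eps (column_crystal m n r) i x)"
        using y by (simp_all add: column_ops[OF i x] column_ops[OF i y(1)])
      show "i = 0 \<Longrightarrow> h0 (wt (column_crystal m n r) y) = h0 (wt (column_crystal m n r) x)"
        using h x l by blast
    next
      assume "e_op (column_crystal m n r) i x = Some y"
      then have l: "raise i x = Some y" using x by (simp add: column_ops[OF i])
      note y = raise_facts[OF i x l]
      show "y \<in> columns m n r" by (fact y)
      show "f_op (column_crystal m n r) i y = Some x" using y by (simp add: column_ops[OF i y(1)])
    }
  qed
qed

text \<open>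
  A bijection that commutes with the \<open>f\<^sub>i\<close> maps the graph of each \<open>f\<^sub>i\<close> onto the other one; by
  adjointness these graphs are the reversed graphs of the \<open>e\<^sub>i\<close>. So it is enough to check \<open>f\<^sub>i\<close>
  in one direction.
\<close>

lemma crystal_iso_pairI:
  assumes "\<And>x. x \<in> carrier C \<Longrightarrow> F x \<in> carrier D \<and> G (F x) = x \<and> wt D (F x) = wt C x"
    and "\<And>y. y \<in> carrier D \<Longrightarrow> G y \<in> carrier C \<and> F (G y) = y"
    and "\<And>i. i \<in> colours m n \<Longrightarrow> adjoint_at C i \<and> adjoint_at D i"
    and "\<And>i x. i \<in> colours m n \<Longrightarrow> x \<in> carrier C \<Longrightarrow> f_op D i (F x) = map_option F (f_op C i x)"
  shows "crystal_iso m n C D F" "crystal_iso m n D C G"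
proof -
  have bij: "bij_betw F (carrier C) (carrier D)" "bij_betw G (carrier D) (carrier C)"
    using assms(1,2) by (auto intro!: bij_betw_byWitness[where f' = G] bij_betw_byWitness[where f' = F])
  have C: "f_op C i x = Some y \<longleftrightarrow> e_op C i y = Some x"
    if "i \<in> colours m n" "x \<in> carrier C" "y \<in> carrier C" for i x y
    using assms(3)[OF that(1)] that unfolding adjoint_at_def by blast
  have D: "f_op D i x = Some y \<longleftrightarrow> e_op D i y = Some x"
    if "i \<in> colours m n" "x \<in> carrier D" "y \<in> carrier D" for i x y
    using assms(3)[OF that(1)] that unfolding adjoint_at_def by blast
  have clC: "y \<in> carrier C" if "i \<in> colours m n" "x \<in> carrier C" "f_op C i x = Some y \<or> e_op C i x = Some y" for i x y
    using assms(3)[OF that(1)] that unfolding adjoint_at_def by blast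
  have clD: "y \<in> carrier D" if "i \<in> colours m n" "x \<in> carrier D" "f_op D i x = Some y \<or> e_op D i x = Some y" for i x y
    using assms(3)[OF that(1)] that unfolding adjoint_at_def by blast
  have e: "e_op D i (F x) = map_option F (e_op C i x)" if i: "i \<in> colours m n" and x: "x \<in> carrier C" for i x
  proof -
    have Fx: "F x \<in> carrier D" using assms(1) x by blast
    have "e_op D i (F x) = Some (F y)" if "e_op C i x = Some y" for y
    proof -
      have y: "y \<in> carrier C" using clC[OF i x] that by blast
      then have "f_op C i y = Some x" using C[OF i y x] that by blast
      then have "f_op D i (F y) = Some (F x)" using assms(4)[OF i y] by simp
      then show ?thesis using D[OF i _ Fx] assms(1)[OF y] by blast
    qed
    moreover have "e_op C i x \<noteq> None" if "e_op D i (F x) = Some y" for y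
    proof -
      have y: "y \<in> carrier D" using clD[OF i Fx] that by blast
      then have "f_op D i y = Some (F x)" using D[OF i y Fx] that by blast
      then have "map_option F (f_op C i (G y)) = Some (F x)" using assms(4)[OF i, of "G y"] assms(2)[OF y] by simp
      then obtain z where z: "f_op C i (G y) = Some z" "F z = F x" by auto
      then have "z \<in> carrier C" using clC[OF i] assms(2)[OF y] by blast
      then have "z = x" using z(2) assms(1) x by metis
      then show ?thesis using C[OF i _ x] assms(2)[OF y] z by blast
    qed
    ultimately show ?thesis by (cases "e_op C i x"; cases "e_op D i (F x)") auto
  qed
  show "crystal_iso m n C D F"
    using bij assms(1,4) e by (simp add: crystal_iso_def)
  have "wt C (G y) = wt D y \<and> (\<forall>i\<in>colours m n. e_op C i (G y) = map_option G (e_op D i y) \<and>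
      f_op C i (G y) = map_option G (f_op D i y))" if y: "y \<in> carrier D" for y
  proof -
    obtain x where x: "x \<in> carrier C" "y = F x" using assms(2)[OF y] by metis
    have "map_option G (map_option F (g x)) = g x" if "\<And>z. g x = Some z \<Longrightarrow> z \<in> carrier C" for g
      using that assms(1) by (cases "g x") auto
    then show ?thesis using x assms(1)[OF x(1)] assms(4) e clC by simp
  qed
  then show "crystal_iso m n D C G" using bij by (simp add: crystal_iso_def)
qed

section \<open>Insertion commutes with the operators\<close>

lemma tensor_column_letter_f:
  assumes i: "i \<in> colours m n" and a: "a \<in> columns m n r"
  shows "f_op (tensor (column_crystal m n r) (letter_crystal m n)) i (a, b) =
    (if (if i < 0 then lowerable i a \<and> b \<noteq> arrow_target i
         else if i > 0 then \<not> (b = arrow_source i \<and> arrow_target i \<notin> set a)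
         else arrow_source i \<in> set a \<or> arrow_target i \<in> set a)
     then map_option (\<lambda>a'. (a', b)) (lower i a)
     else if b = arrow_source i then Some (a, arrow_target i) else None)"
proof -
  have h: "0 < int (count (mset a) (-1)) + int (count (mset a) 1) \<longleftrightarrow> -1 \<in> set a \<or> 1 \<in> set a"
    using mem_set_iff_count[of "-1" a] mem_set_iff_count[of 1 a] by linarith
  have n: "count (mset a) x < of_bool P \<longleftrightarrow> P \<and> x \<notin> set a" for P x
    by (simp add: of_bool_def)
  note simps = tensor_def Let_def letter_ops[OF i] column_ops[OF i a]
  consider "i < 0" | "i = 0" | "i > 0" by linarith
  then show ?thesis
  proof cases
    case 1
    then show ?thesis by (simp add: simps col_phi_def of_bool_def)
  next
    case 2
    then show ?thesis
      using h by (simp add: simps[unfolded 2] h0_column[OF a] arrow_source_def arrow_target_def)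
  next
    case 3
    then show ?thesis by (simp add: simps col_eps_def n)
  qed
qed

lemma tensor_letter_column_f:
  assumes i: "i \<in> colours m n" and a: "a \<in> columns m n r"
  shows "f_op (tensor (letter_crystal m n) (column_crystal m n r)) i (b, a) =
    (if (if i < 0 then b = arrow_source i \<and> \<not> raisable i a
         else if i > 0 then count (mset a) (arrow_source i) \<le> of_bool (b = arrow_target i)
         else b = arrow_source i \<or> b = arrow_target i)
     then (if b = arrow_source i then Some (arrow_target i, a) else None)
     else map_option (Pair b) (lower i a))"
proof -
  have "h0 (Poly_Mapping.single b 1) = of_bool (b = -1 \<or> b = 1)"
    by (auto simp: h0_def lookup_single when_def)
  then have h: "0 < h0 (Poly_Mapping.single b 1) \<longleftrightarrow> b = -1 \<or> b = 1" by simp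
  note simps = tensor_def Let_def letter_ops[OF i] column_ops[OF i a]
  consider "i < 0" | "i = 0" | "i > 0" by linarith
  then show ?thesis
  proof cases
    case 1
    then show ?thesis by (simp add: simps col_eps_def of_bool_def)
  next
    case 2
    then show ?thesis by (simp add: simps[unfolded 2] h arrow_source_def arrow_target_def)
  next
    case 3
    then show ?thesis by (simp add: simps col_phi_def not_less)
  qed
qed

text \<open>
  Replacing \<open>s\<close> by the adjacent letter \<open>t\<close> does not disturb the order of the entries, and under the
  hypothesis on \<open>b\<close> it does not disturb which of them follow \<open>b\<close>. So the successor is the same
  entry as before, renamed if it was the only \<open>s\<close>. The hypothesis fails only if
  \<open>b = s > 0\<close> or \<open>b = t < 0\<close>.
\<close>

lemma bump_up_after_lower:
  assumes i: "i \<in> colours m n" and a: "a \<in> columns m n r" and b: "b \<in> letters m n"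
    and s: "arrow_source i \<in> set a"
    and H: "precedes b (arrow_source i) \<longleftrightarrow> precedes b (arrow_target i)"
  defines "a' \<equiv> exchange (arrow_source i) (arrow_target i) a" and "c \<equiv> bump_up (set a) b"
  shows "bump_up (set a') b =
    (if c = arrow_source i \<and> arrow_source i \<notin> set a' then arrow_target i else c)"
proof -
  note A = arrow_facts[OF i]
  let ?s = "arrow_source i" and ?t = "arrow_target i"
  have ne: "set a \<noteq> {}" "set a' \<noteq> {}" using s by (auto simp: a'_def exchange_def set_insort_key)
  have c: "c \<in> set a" "precedes b c \<and> (\<forall>x\<in>set a. precedes b x \<longrightarrow> c \<le> x) \<or>
     (\<forall>x\<in>set a. \<not> precedes b x \<and> c \<le> x)"
    using bump_up_eq_iff[OF finite_set ne(1), of b c] by (simp_all add: c_def)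
  have mem: "z \<in> set a' \<longleftrightarrow> z = ?t \<or> z \<in> set a \<and> (z = ?s \<longrightarrow> count (mset a) ?s > 1)" for z
    unfolding a'_def by (rule set_exchange_iff[OF s])
  have gap: "x \<le> ?s \<or> ?t \<le> x" if "x \<in> set a" for x
    using A(6) that a by (auto simp: columns_iff)
  define e where "e = (if c = ?s \<and> ?s \<notin> set a' then ?t else c)"
  have e: "e \<in> set a'" using c(1) mem by (auto simp: e_def)
  have pe: "precedes b e \<longleftrightarrow> precedes b c" using H by (auto simp: e_def)
  (* Covers both alternatives at once: x ranges over the entries following b, or over all of
     them when no entry follows b. *)
  have le: "e \<le> x" if "x \<in> set a'" "precedes b x \<longrightarrow> precedes b c" "\<And>x. x \<in> set a \<Longrightarrow> precedes b x \<or> \<not> precedes b c \<Longrightarrow> c \<le> x" 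
    "precedes b x \<or> \<not> precedes b c" for x
  proof (cases "x \<in> set a")
    case True
    then have "c \<le> x" using that by blast
    then show ?thesis using gap[OF True] that(1) unfolding e_def by auto
  next
    case False
    then have "x = ?t" using mem that(1) by blast
    moreover have "c \<le> ?s" using that(3)[OF s] H that(4) calculation by blast
    ultimately show ?thesis using A(3) unfolding e_def by auto
  qed
  show ?thesis unfolding e_def[symmetric] bump_up_eq_iff[OF finite_set ne(2)] pe
  proof (rule conjI[OF e], cases "precedes b c")
    case True
    then show "precedes b c \<and> (\<forall>x\<in>set a'. precedes b x \<longrightarrow> e \<le> x) \<or>
        (\<forall>x\<in>set a'. \<not> precedes b x \<and> e \<le> x)"
      using c le by blast
  next
    case False
    then have "\<not> precedes b x" if "x \<in> set a'" for x
      using c(2) H s mem[of x] that False by metis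
    then show "precedes b c \<and> (\<forall>x\<in>set a'. precedes b x \<longrightarrow> e \<le> x) \<or>
        (\<forall>x\<in>set a'. \<not> precedes b x \<and> e \<le> x)"
      using c le False by blast
  qed
qed

lemma bump_up_cong:
  "(\<And>x. x \<in> A \<Longrightarrow> precedes b x \<longleftrightarrow> precedes b' x) \<Longrightarrow> bump_up A b = bump_up A b'"
  unfolding bump_up_def by (metis (mono_tags, lifting) Collect_cong)

text \<open>
  With \<open>\<Psi> (a, b) = (c, d)\<close> there are three patterns. If \<open>f\<^sub>i\<close> acts on \<open>a\<close> and the successor of
  \<open>b\<close> stays \<open>c\<close>, then \<open>f\<^sub>i\<close> acts on \<open>d\<close>. If it acts on \<open>a\<close> and the successor moves from \<open>s\<close> to
  \<open>t\<close>, then it acts on \<open>c\<close>. If it acts on \<open>b = s\<close>, then the new letter \<open>t\<close> normally has the same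
  successor as \<open>s\<close>, and \<open>f\<^sub>i\<close> acts on \<open>d\<close>, which contains \<open>b\<close>. The sign of \<open>i\<close> decides
  when each pattern occurs and when the result is undefined on both sides.
\<close>

lemma insert_up_commutes_f:
  assumes i: "i \<in> colours m n" and a: "a \<in> columns m n r" and b: "b \<in> letters m n" and r: "r \<ge> 1"
  shows "f_op (tensor (letter_crystal m n) (column_crystal m n r)) i (insert_up (a, b)) =
    map_option insert_up (f_op (tensor (column_crystal m n r) (letter_crystal m n)) i (a, b))"
proof -
  define s t where "s = arrow_source i" and "t = arrow_target i"
  note st = s_def[symmetric] t_def[symmetric]
  note A = arrow_facts[OF i, unfolded st]
  define c where "c = bump_up (set a) b"
  define d where "d = exchange c b a"
  note cd = bump_up_facts[OF a r b, folded c_def, folded d_def]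
  have srt: "sorted a" using a by (simp add: columns_iff)
  have ne: "set a \<noteq> {}" using a r by (auto simp: columns_iff)
  have c: "precedes b c \<and> (\<forall>x\<in>set a. precedes b x \<longrightarrow> c \<le> x) \<or>
     (\<forall>x\<in>set a. \<not> precedes b x \<and> c \<le> x)"
    using bump_up_eq_iff[OF finite_set ne, of b c] by (simp add: c_def)
  have d: "z \<in> set d \<longleftrightarrow> z = b \<or> z \<in> set a \<and> (z = c \<longrightarrow> count (mset a) c > 1)" for z
    unfolding d_def by (rule set_exchange_iff[OF cd(1)])
  have count_d: "int (count (mset d) z) = int (count (mset a) z) - of_bool (z = c) + of_bool (z = b)" for z
    unfolding d_def by (rule count_exchange[OF cd(1)])
  have one: "x < 0 \<Longrightarrow> \<not> count (mset a) x > 1" for x by (rule column_multiplicity[OF a])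
  have gap: "x \<le> s \<or> t \<le> x" if "x \<in> set a" for x
    using A(6) that a by (auto simp: columns_iff)
  have gapb: "b \<le> s \<or> t \<le> b" using A(6) b by blast
  have up: "insert_up (a, b) = (c, d)" by (simp add: insert_up_def c_def d_def Let_def)
  note F = tensor_column_letter_f[OF i a, unfolded st, of b]
  note G = tensor_letter_column_f[OF i cd(3), unfolded st, of c]
  \<comment> \<open>The names of the three patterns list the factor changed before and after insertion.\<close>
  have col_col: "insert_up (exchange s t a, b) = (c, exchange s t d)"
    if "s \<in> set a" "s \<in> set d" "c \<in> set (exchange s t a)" "bump_up (set (exchange s t a)) b = c"
    using that exchange_commute[OF srt cd(1), of s b t] by (simp add: insert_up_def d_def)
  have col_let: "insert_up (exchange s t a, b) = (t, d)"
    if "c = s" "bump_up (set (exchange s t a)) b = t"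
    using that cd(1) exchange_exchange[OF srt, of s t b] by (simp add: insert_up_def d_def)
  have let_col: "insert_up (a, t) = (c, exchange s t d)"
    if "b = s" "bump_up (set a) t = c"
    using that exchange_exchange[OF srt cd(1), of s t] by (simp add: insert_up_def d_def)
  have same: "bump_up (set a) t = c" if "b = s" "\<And>x. x \<in> set a \<Longrightarrow> precedes s x \<longleftrightarrow> precedes t x"
    using bump_up_cong[OF that(2)] that(1) by (simp add: c_def)
  have mem1: "z \<in> set (exchange s t a) \<longleftrightarrow> z = t \<or> z \<in> set a \<and> (z = s \<longrightarrow> count (mset a) s > 1)"
    if "s \<in> set a" for z by (rule set_exchange_iff[OF that])
  have low: "bump_up (set (exchange s t a)) b = (if c = s \<and> s \<notin> set (exchange s t a) then t else c)"
    if "s \<in> set a" "precedes b s \<longleftrightarrow> precedes b t"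
    using bump_up_after_lower[OF i a b, folded s_def t_def, OF that] by (simp add: c_def)
  consider "i < 0" | "i = 0" | "i > 0" by linarith
  then show ?thesis
  proof cases
    case 1
    have neg: "s < 0" "t < 0" "s < t" using A 1 by auto
    have s1: "s \<notin> set (exchange s t a)" if "s \<in> set a" using mem1[OF that] one neg by auto
    have G': "f_op (tensor (letter_crystal m n) (column_crystal m n r)) i (c, d) =
      (if c = s \<and> \<not> (t \<in> set d \<and> s \<notin> set d) then Some (t, d)
       else if s \<in> set d \<and> t \<notin> set d then Some (c, exchange s t d) else None)"
      using G 1 by (auto simp: raisable_def lower_def lowerable_def st)
    have F': "f_op (tensor (column_crystal m n r) (letter_crystal m n)) i (a, b) =
      (if s \<in> set a \<and> t \<notin> set a \<and> b \<noteq> t then Some (exchange s t a, b)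
       else if b = s then Some (a, t) else None)"
      using F 1 by (auto simp: lower_def lowerable_def st)
    have d1: "z \<in> set d \<longleftrightarrow> z = b \<or> z \<in> set a \<and> z \<noteq> c" if "z < 0" for z
      using d one[of z] that by auto
    show ?thesis
    proof (cases "s \<in> set a \<and> t \<notin> set a \<and> b \<noteq> t")
      case True
      then have H: "precedes b s \<longleftrightarrow> precedes b t" using gapb neg by (auto simp: precedes_def)
      note low' = low[OF _ H] s1
      show ?thesis
      proof (cases "c = s")
        case True': True
        then show ?thesis unfolding up F' G'
          using True low' d1[of t] neg col_let by simp
      next
        case False
        then have "c \<in> set (exchange s t a)" using mem1 True cd(1) by blast
        then show ?thesis unfolding up F' G'
          using True False low' d1[of t] d1[of s] neg col_col by simp
      qed
    next
      case N: False
      show ?thesis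
      proof (cases "b = s")
        case bs: True
        show ?thesis
        proof (cases "s \<in> set a")
          case True
          \<comment> \<open>Both \<open>s\<close> and \<open>t\<close> are negative entries, so each is its own successor and insertion
            only swaps the factors.\<close>
          have "c = s" using c True bs neg by (force simp: precedes_def)
          moreover have "bump_up (set a) t = t"
            using N True bs neg unfolding bump_up_eq_iff[OF finite_set ne] precedes_def by auto
          moreover have "t \<in> set a" using N True bs neg by auto
          moreover have "d = a" using exchange_same[OF srt True] \<open>c = s\<close> bs by (simp add: d_def)
          moreover have "insert_up (a, t) = (t, a)"
            using exchange_same[OF srt] calculation by (simp add: insert_up_def)
          ultimately show ?thesis unfolding up F' G' using bs True neg by auto
        next
          case False
          have "precedes s x \<longleftrightarrow> precedes t x" if "x \<in> set a" for x
            using gap[OF that] neg that False by (auto simp: precedes_def)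
          note s2 = same[OF bs this]
          have "t \<in> set a \<Longrightarrow> c = t" using c bs neg gap[OF cd(1)] False cd(1)
            by (force simp: precedes_def)
          then have "s \<in> set d" "t \<notin> set d" "c \<noteq> s"
            using bs False cd(1) d1[of s] d1[of t] neg by auto
          then show ?thesis unfolding up F' G' using let_col[OF bs s2] bs False by simp
        qed
      next
        case bs: False
        \<comment> \<open>Here \<open>f\<^sub>i\<close> vanishes before insertion. Afterwards \<open>t\<close> in \<open>d\<close> cancels any \<open>s\<close>, whether
          that is \<open>c\<close> or an entry of \<open>d\<close>.\<close>
        have "t \<in> set d \<and> s \<notin> set d" if "c = s" using that cd(1) N bs d1[of s] d1[of t] neg by auto
        moreover have "t \<in> set d" if "s \<in> set d"
        proof (rule ccontr)
          assume "t \<notin> set d"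
          then have *: "s \<in> set a" "c = t" "b \<noteq> t" using that N bs d1[of s] d1[of t] neg by auto
          then show False using c gapb neg bs by (auto simp: precedes_def)
        qed
        ultimately show ?thesis unfolding up F' G'
          using N bs by auto
      qed
    qed
  next
    case 2
    have neg: "s < 0" "t > 0" "s < t" using 2 by (auto simp: s_def t_def arrow_source_def arrow_target_def)
    have s1: "s \<notin> set (exchange s t a)" if "s \<in> set a" using mem1[OF that] one neg by auto
    have G': "f_op (tensor (letter_crystal m n) (column_crystal m n r)) i (c, d) =
      (if c = s then Some (t, d) else if c \<noteq> t \<and> s \<in> set d then Some (c, exchange s t d) else None)"
      using G 2 by (simp add: lower_def lowerable_def st st[unfolded 2])
    have F': "f_op (tensor (column_crystal m n r) (letter_crystal m n)) i (a, b) =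
      (if s \<in> set a then Some (exchange s t a, b)
       else if t \<notin> set a \<and> b = s then Some (a, t) else None)"
      using F 2 by (auto simp: lower_def lowerable_def st st[unfolded 2])
    have ds: "s \<in> set d \<longleftrightarrow> s = b \<or> s \<in> set a \<and> s \<noteq> c"
      using d one[of s] neg by auto
    show ?thesis
    proof (cases "s \<in> set a")
      case True
      then have H: "precedes b s \<longleftrightarrow> precedes b t" using gapb neg by (auto simp: precedes_def)
      note low' = low[OF True H] s1[OF True]
      show ?thesis
      proof (cases "c = s")
        case True': True
        then show ?thesis unfolding up F' G'
          using True low' col_let by simp
      next
        case False
        then have "c \<in> set (exchange s t a)" using mem1 True cd(1) by blast
        moreover have "c \<noteq> t" using c True H neg by fastforce
        ultimately show ?thesis unfolding up F' G'
          using True False low' ds neg col_col by simp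
      qed
    next
      case sa: False
      then have "c \<noteq> s" using cd(1) by blast
      show ?thesis
      proof (cases "b = s")
        case bs: True
        show ?thesis
        proof (cases "t \<in> set a")
          case True
          then have "c = t" using c bs neg gap[OF cd(1)] sa cd(1) by (force simp: precedes_def)
          then show ?thesis unfolding up F' G'
            using sa True neg by simp
        next
          case False
          have "precedes s x \<longleftrightarrow> precedes t x" if "x \<in> set a" for x
          proof -
            have "x \<noteq> s" "x \<noteq> t" using that False sa by auto
            then show ?thesis using gap[OF that] neg unfolding precedes_def by linarith
          qed
          note s2 = same[OF bs this]
          have "c \<noteq> t" using cd(1) False by blast
          then show ?thesis unfolding up F' G'
            using let_col[OF bs s2] bs False sa \<open>c \<noteq> s\<close> ds by simp
        qed
      next
        case False
        then show ?thesis unfolding up F' G'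
          using sa \<open>c \<noteq> s\<close> ds by simp
      qed
    qed
  next
    case 3
    have pos: "s > 0" "t > 0" "s < t" using 3 by (auto simp: s_def t_def arrow_source_def arrow_target_def)
    have G': "f_op (tensor (letter_crystal m n) (column_crystal m n r)) i (c, d) =
      (if s \<notin> set d \<or> c = t \<and> count (mset d) s \<le> 1 then (if c = s then Some (t, d) else None)
       else Some (c, exchange s t d))"
      using G 3 count_mset_0_iff[of d s]
      by (cases "s \<in> set d") (auto simp: lower_def lowerable_def st simp del: count_mset_0_iff)
    have F': "f_op (tensor (column_crystal m n r) (letter_crystal m n)) i (a, b) =
      (if b = s \<and> t \<notin> set a then Some (a, t)
       else if s \<in> set a then Some (exchange s t a, b) else None)"
      using F 3 by (auto simp: lower_def lowerable_def st)
    show ?thesis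
    proof (cases "b = s")
      case bs: True
      then have sd: "s \<in> set d" using d by blast
      show ?thesis
      proof (cases "t \<in> set a")
        case False
        have "precedes s x \<longleftrightarrow> precedes t x" if "x \<in> set a" for x
        proof -
          have "x \<noteq> t" using that False by auto
          then show ?thesis using gap[OF that] pos unfolding precedes_def by linarith
        qed
        note s2 = same[OF bs this]
        have "c \<noteq> t" using cd(1) False by blast
        then show ?thesis unfolding up F' G'
          using let_col[OF bs s2] bs False sd by simp
      next
        case True
        then have ct: "c = t" using c bs pos gap[OF cd(1)] cd(1) by (force simp: precedes_def)
        have cnt: "int (count (mset d) s) = int (count (mset a) s) + 1"
          using count_d[of s] bs ct pos by simp
        show ?thesis
        proof (cases "s \<in> set a")
          case True': True
          \<comment> \<open>Since \<open>s\<close> precedes \<open>t\<close> but not itself, the successor of \<open>b = s\<close> is \<open>t\<close> both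
            before and after the exchange. The letter \<open>c = t\<close> cancels one \<open>s\<close> of \<open>d\<close>, but \<open>d\<close> has
            at least two.\<close>
          have "count (mset a) s > 0" using True' by simp
          then have "\<not> count (mset d) s \<le> 1" using cnt by linarith
          moreover have "bump_up (set (exchange s t a)) b = c"
          proof -
            have "t \<in> set (exchange s t a)" using mem1[OF True'] by simp
            moreover from this have "set (exchange s t a) \<noteq> {}" by auto
            moreover have "t \<le> x" if "x \<in> set (exchange s t a)" "precedes s x" for x
              using that mem1[OF True', of x] gap[of x] pos by (auto simp: precedes_def)
            ultimately show ?thesis using pos
              unfolding bs ct by (subst bump_up_eq_iff) (auto simp: precedes_def)
          qed
          ultimately show ?thesis unfolding up F' G'
            using True True' col_col[OF True' sd] mem1[OF True'] ct sd by simp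
        next
          case False
          have "count (mset a) s = 0" using False by simp
          then have "count (mset d) s \<le> 1" using cnt by linarith
          then show ?thesis unfolding up F' G'
            using True False ct pos by simp
        qed
      qed
    next
      case bs: False
      show ?thesis
      proof (cases "s \<in> set a")
        case True
        have H: "precedes b s \<longleftrightarrow> precedes b t" using gapb pos bs by (auto simp: precedes_def)
        note low' = low[OF True H]
        have "c \<noteq> t" using c True H pos by fastforce
        show ?thesis
        proof (cases "s \<in> set d")
          case sd: True
          then have "c \<in> set (exchange s t a)" using mem1[OF True] d[of s] bs cd(1) by blast
          moreover from this have "bump_up (set (exchange s t a)) b = c" using low' by auto
          ultimately show ?thesis unfolding up F' G'
            using col_col[OF True sd] True bs sd \<open>c \<noteq> t\<close> by simp
        next
          case False
          then have cs: "c = s" "\<not> count (mset a) s > 1" using d[of s] True by auto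
          then have "s \<notin> set (exchange s t a)" using mem1[OF True, of s] cs pos by auto
          then show ?thesis unfolding up F' G'
            using col_let low' True bs False cs by simp
        qed
      next
        case False
        then have "s \<notin> set d" "c \<noteq> s" using d bs cd(1) by auto
        then show ?thesis unfolding up F' G'
          using False bs by simp
      qed
    qed
  qed
qed

section \<open>The explicit description\<close>

lemma repeated_entry_pair_iff:
  "(\<forall>i j. i < j \<and> j < length [x, y] \<and> [x, y] ! i = [x, y] ! j \<longrightarrow> [x, y] ! i \<in> S) \<longleftrightarrow>
    (x = y \<longrightarrow> x \<in> S)" (is "?L \<longleftrightarrow> ?R")
proof
  assume L: ?L
  show ?R using L[rule_format, of 0 1] by simp
next
  assume R: ?R
  show ?L
  proof (intro allI impI, elim conjE)
    fix i j assume *: "i < j" "j < length [x, y]" "[x, y] ! i = [x, y] ! j"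
    have "i = 0 \<and> j = 1" using *(1,2) by auto
    then show "[x, y] ! i \<in> S" using R *(3) by simp
  qed
qed

text \<open>
  The conditions for two-box rows and columns are complementary, and \<open>precedes\<close> decides between
  them.
\<close>

lemma row_iff_precedes:
  assumes "x \<in> letters m n" "y \<in> letters m n"
  shows "semistandard_row m n [x, y] \<longleftrightarrow> precedes x y"
  using assms unfolding semistandard_row_def repeated_entry_pair_iff
  by (auto simp: precedes_def letters_iff B_plus_def)

lemma column_iff_not_precedes:
  assumes "x \<in> letters m n" "y \<in> letters m n"
  shows "semistandard_column m n [x, y] \<longleftrightarrow> \<not> precedes y x"
  using assms unfolding semistandard_column_def repeated_entry_pair_iff
  by (auto simp: precedes_def letters_iff B_minus_def)

lemma sorted_le_last: "sorted a \<Longrightarrow> x \<in> set a \<Longrightarrow> x \<le> last a"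
  by (induction a) auto

lemma exchange_nth_eq_list_update:
  assumes "sorted a" "k < length a"
    and "\<And>j. j < k \<Longrightarrow> a ! j \<le> b" "\<And>j. k < j \<Longrightarrow> j < length a \<Longrightarrow> b \<le> a ! j"
  shows "exchange (a ! k) b a = a[k := b]"
proof (rule sorted_eq_if_count_eq)
  show "sorted (a[k := b])"
    using assms by (auto simp: sorted_iff_nth_mono_less nth_list_update)
  have "a ! k \<in> set a" using assms by simp
  then show "int (count (mset (exchange (a ! k) b a)) z) = int (count (mset (a[k := b])) z)" for z
    using assms(2) by (simp add: mset_update exchange_def)
qed (use assms in \<open>simp add: sorted_exchange\<close>)

text \<open>
  If \<open>b\<close> fits below the bottom entry, then no entry follows \<open>b\<close>, so the successor is the top entry.
\<close>

lemma insert_up_column: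
  assumes a: "a \<in> columns m n r" and r: "r \<ge> 1" and b: "b \<in> letters m n"
    and "semistandard_column m n [last a, b]"
  shows "insert_up (a, b) = (hd a, tl a @ [b])"
proof -
  have srt: "sorted a" and ne: "a \<noteq> []" and sub: "set a \<subseteq> letters m n"
    using a r by (auto simp: columns_iff)
  have "\<not> precedes b (last a)" using assms sub ne by (simp add: column_iff_not_precedes subset_iff)
  moreover have "x \<le> last a" if "x \<in> set a" for x
    using sorted_le_last[OF srt that] .
  ultimately have no: "\<not> precedes b x \<and> x \<le> b" if "x \<in> set a" for x
    using that by (force simp: precedes_def)
  have hd: "bump_up (set a) b = hd a"
  proof (subst bump_up_eq_iff)
    show "hd a \<in> set a \<and> (precedes b (hd a) \<and> (\<forall>x\<in>set a. precedes b x \<longrightarrow> hd a \<le> x) \<or>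
      (\<forall>x\<in>set a. \<not> precedes b x \<and> hd a \<le> x))"
      using no srt ne by (cases a) auto
  qed (use ne in auto)
  have "exchange (hd a) b a = insort b (tl a)" using ne by (cases a) (auto simp: exchange_def)
  also have "\<dots> = tl a @ [b]" using no srt ne by (cases a) (auto intro!: sorted_insort_is_snoc)
  finally show ?thesis by (simp add: insert_up_def hd)
qed

lemma insert_up_row:
  assumes a: "a \<in> columns m n r" and r: "r \<ge> 1" and b: "b \<in> letters m n"
    and row: "semistandard_row m n [b, last a]"
  defines "\<nu> \<equiv> LEAST k. k < r \<and> semistandard_row m n [b, a ! k]"
  shows "insert_up (a, b) = (a ! \<nu>, a[\<nu> := b])"
proof -
  have srt: "sorted a" and ne: "a \<noteq> []" and sub: "set a \<subseteq> letters m n" and len: "length a = r"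
    using a r by (auto simp: columns_iff)
  have iff: "semistandard_row m n [b, a ! k] \<longleftrightarrow> precedes b (a ! k)" if "k < r" for k
    using row_iff_precedes[OF b subsetD[OF sub nth_mem]] that len by simp
  have "r - 1 < r \<and> semistandard_row m n [b, a ! (r - 1)]"
    using row r ne len by (simp add: last_conv_nth)
  then have nu: "\<nu> < r \<and> semistandard_row m n [b, a ! \<nu>]" unfolding \<nu>_def by (rule LeastI)
  have below: "\<not> precedes b (a ! j)" if "j < \<nu>" for j
    using not_less_Least[of j "\<lambda>k. k < r \<and> semistandard_row m n [b, a ! k]"] that nu iff
    unfolding \<nu>_def[symmetric] by auto
  have p: "precedes b (a ! \<nu>)" using nu iff by blast
  have "bump_up (set a) b = a ! \<nu>"
  proof (subst bump_up_eq_iff)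
    have "a ! \<nu> \<le> x" if x: "x \<in> set a" "precedes b x" for x
    proof -
      obtain j where j: "x = a ! j" "j < length a" using x by (metis in_set_conv_nth)
      then have "\<nu> \<le> j" using below x not_le by blast
      then show ?thesis using srt j by (simp add: sorted_nth_mono)
    qed
    then show "a ! \<nu> \<in> set a \<and> (precedes b (a ! \<nu>) \<and> (\<forall>x\<in>set a. precedes b x \<longrightarrow> a ! \<nu> \<le> x) \<or>
      (\<forall>x\<in>set a. \<not> precedes b x \<and> a ! \<nu> \<le> x))"
      using p nu len by simp
  qed (use ne in auto)
  moreover have "exchange (a ! \<nu>) b a = a[\<nu> := b]"
  proof (rule exchange_nth_eq_list_update[OF srt])
    show "a ! j \<le> b" if "j < \<nu>" for j using below[OF that] by (auto simp: precedes_def)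
    show "b \<le> a ! j" if "\<nu> < j" "j < length a" for j
      using p sorted_nth_mono[OF srt, of \<nu> j] that by (auto simp: precedes_def)
  qed (use nu len in simp)
  ultimately show ?thesis by (simp add: insert_up_def)
qed

text \<open>
  If \<open>b\<close> fits above the top entry, then no entry comes before \<open>b\<close>, so the predecessor is the bottom
  entry.
\<close>

lemma insert_down_column:
  assumes a: "a \<in> columns m n r" and r: "r \<ge> 1" and b: "b \<in> letters m n"
    and "semistandard_column m n [b, hd a]"
  shows "insert_down (b, a) = (b # butlast a, last a)"
proof -
  have srt: "sorted a" and ne: "a \<noteq> []" and sub: "set a \<subseteq> letters m n"
    using a r by (auto simp: columns_iff)
  have "\<not> precedes (hd a) b" using assms sub ne by (simp add: column_iff_not_precedes subset_iff)
  moreover have "hd a \<le> x" if "x \<in> set a" for x using srt that by (cases a) auto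
  ultimately have no: "\<not> precedes x b \<and> b \<le> x" if "x \<in> set a" for x
    using that by (force simp: precedes_def)
  have split: "a = butlast a @ [last a]" using ne by simp
  then have last: "sorted (butlast a)" "\<And>x. x \<in> set a \<Longrightarrow> x \<le> last a"
    using srt sorted_le_last by (metis sorted_append)+
  have "bump_down (set a) b = last a"
  proof (subst bump_down_eq_iff)
    show "last a \<in> set a \<and> (precedes (last a) b \<and> (\<forall>x\<in>set a. precedes x b \<longrightarrow> x \<le> last a) \<or>
      (\<forall>x\<in>set a. \<not> precedes x b \<and> x \<le> last a))"
      using no last ne by simp
  qed (use ne in auto)
  moreover have "exchange (last a) b a = b # butlast a"
  proof (rule sorted_eq_if_count_eq)
    show "sorted (b # butlast a)" using last no by (auto dest: in_set_butlastD)
    have "mset a = add_mset (last a) (mset (butlast a))" by (subst split) simp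
    then show "int (count (mset (exchange (last a) b a)) z) = int (count (mset (b # butlast a)) z)" for z
      by (simp add: exchange_def)
  qed (use srt in \<open>simp add: sorted_exchange\<close>)
  ultimately show ?thesis by (simp add: insert_down_def)
qed

lemma insert_down_row:
  assumes a: "a \<in> columns m n r" and r: "r \<ge> 1" and b: "b \<in> letters m n"
    and row: "semistandard_row m n [hd a, b]"
  defines "\<nu> \<equiv> GREATEST k. k < r \<and> semistandard_row m n [a ! k, b]"
  shows "insert_down (b, a) = (a[\<nu> := b], a ! \<nu>)"
proof -
  have srt: "sorted a" and ne: "a \<noteq> []" and sub: "set a \<subseteq> letters m n" and len: "length a = r"
    using a r by (auto simp: columns_iff)
  have iff: "semistandard_row m n [a ! k, b] \<longleftrightarrow> precedes (a ! k) b" if "k < r" for k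
    using row_iff_precedes[OF subsetD[OF sub nth_mem] b] that len by simp
  have 0: "0 < r \<and> semistandard_row m n [a ! 0, b]"
    using row r ne len by (simp add: hd_conv_nth)
  have nu: "\<nu> < r \<and> semistandard_row m n [a ! \<nu>, b]" unfolding \<nu>_def
    by (rule GreatestI_nat[where P = "\<lambda>k. k < r \<and> semistandard_row m n [a ! k, b]" and b = r, OF 0]) simp
  have above: "\<not> precedes (a ! j) b" if "\<nu> < j" "j < r" for j
  proof
    assume "precedes (a ! j) b"
    then have "j \<le> \<nu>" unfolding \<nu>_def using that iff
      by (intro Greatest_le_nat[where b = r]) auto
    then show False using that by simp
  qed
  have p: "precedes (a ! \<nu>) b" using nu iff by blast
  have "bump_down (set a) b = a ! \<nu>"
  proof (subst bump_down_eq_iff)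
    have "x \<le> a ! \<nu>" if x: "x \<in> set a" "precedes x b" for x
    proof -
      obtain j where j: "x = a ! j" "j < length a" using x by (metis in_set_conv_nth)
      then have "j \<le> \<nu>" using above x not_le len by blast
      then show ?thesis using srt j nu len by (simp add: sorted_nth_mono)
    qed
    then show "a ! \<nu> \<in> set a \<and> (precedes (a ! \<nu>) b \<and> (\<forall>x\<in>set a. precedes x b \<longrightarrow> x \<le> a ! \<nu>) \<or>
      (\<forall>x\<in>set a. \<not> precedes x b \<and> x \<le> a ! \<nu>))"
      using p nu len by simp
  qed (use ne in auto)
  moreover have "exchange (a ! \<nu>) b a = a[\<nu> := b]"
  proof (rule exchange_nth_eq_list_update[OF srt])
    show "a ! j \<le> b" if "j < \<nu>" for j
      using p sorted_nth_mono[OF srt, of j \<nu>] that nu len by (auto simp: precedes_def)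
    show "b \<le> a ! j" if "\<nu> < j" "j < length a" for j
      using above[of j] that len by (auto simp: precedes_def)
  qed (use nu len in simp)
  ultimately show ?thesis by (simp add: insert_down_def)
qed

lemma wt_insert_up:
  assumes "a \<in> columns m n r" "r \<ge> 1" "b \<in> letters m n"
  shows "wt (tensor (letter_crystal m n) (column_crystal m n r)) (insert_up (a, b)) =
    wt (tensor (column_crystal m n r) (letter_crystal m n)) (a, b)"
proof (rule poly_mapping_eqI)
  fix z
  note c = bump_up_facts[OF assms]
  have "length a = r" "length (exchange (bump_up (set a) b) b a) = r"
    using assms(1) c by (auto simp: columns_iff)
  then show "Poly_Mapping.lookup (wt (tensor (letter_crystal m n) (column_crystal m n r)) (insert_up (a, b))) z =
    Poly_Mapping.lookup (wt (tensor (column_crystal m n r) (letter_crystal m n)) (a, b)) z"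
    by (auto simp: insert_up_def tensor_def Let_def lookup_add column_crystal_simps letter_crystal_def
        lookup_wt_tensor_power lookup_single count_exchange[OF c(1)])
qed

theorem theorem4p11:
  fixes m n r :: nat
  assumes "m \<ge> 1" and "n \<ge> 1" and "r \<ge> 1"
  shows "\<exists>(\<Psi> :: letter list \<times> letter \<Rightarrow> letter \<times> letter list)
          (\<Psi>' :: letter \<times> letter list \<Rightarrow> letter list \<times> letter).
    crystal_iso m n (tensor (column_crystal m n r) (letter_crystal m n))
                    (tensor (letter_crystal m n) (column_crystal m n r)) \<Psi> \<and>
    crystal_iso m n (tensor (letter_crystal m n) (column_crystal m n r))
                    (tensor (column_crystal m n r) (letter_crystal m n)) \<Psi>' \<and>
    (\<forall>x \<in> carrier (tensor (column_crystal m n r) (letter_crystal m n)). \<Psi>' (\<Psi> x) = x) \<and>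
    (\<forall>y \<in> carrier (tensor (letter_crystal m n) (column_crystal m n r)). \<Psi> (\<Psi>' y) = y) \<and>
    (\<forall>a \<in> carrier (column_crystal m n r). \<forall>b \<in> carrier (letter_crystal m n).
      (semistandard_column m n [last a, b] \<longrightarrow> \<Psi> (a, b) = (hd a, tl a @ [b])) \<and>
      (semistandard_row m n [b, last a] \<longrightarrow>
        (let \<nu> = (LEAST k. k < r \<and> semistandard_row m n [b, a ! k])
         in \<Psi> (a, b) = (a ! \<nu>, a[\<nu> := b])))) \<and>
    (\<forall>a \<in> carrier (column_crystal m n r). \<forall>b \<in> carrier (letter_crystal m n).
      (semistandard_column m n [b, hd a] \<longrightarrow> \<Psi>' (b, a) = (b # butlast a, last a)) \<and>
      (semistandard_row m n [hd a, b] \<longrightarrow>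
        (let \<nu> = (GREATEST k. k < r \<and> semistandard_row m n [a ! k, b])
         in \<Psi>' (b, a) = (a[\<nu> := b], a ! \<nu>))))"
proof -
  let ?C = "tensor (column_crystal m n r) (letter_crystal m n)"
    and ?D = "tensor (letter_crystal m n) (column_crystal m n r)"
  have car: "carrier (letter_crystal m n) = letters m n" by (simp add: letter_crystal_def)
  have C: "carrier ?C = columns m n r \<times> letters m n" and D: "carrier ?D = letters m n \<times> columns m n r"
    by (simp_all add: tensor_def column_crystal_simps car)
  have up: "insert_up x \<in> carrier ?D \<and> insert_down (insert_up x) = x \<and> wt ?D (insert_up x) = wt ?C x"
    if "x \<in> carrier ?C" for x
  proof -
    obtain a b where x: "x = (a, b)" "a \<in> columns m n r" "b \<in> letters m n" using \<open>x \<in> _\<close> C by auto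
    then show ?thesis
      using bump_up_facts[OF x(2) assms(3) x(3)] insert_down_insert_up[OF x(2) assms(3) x(3)]
        wt_insert_up[OF x(2) assms(3) x(3)]
      by (simp add: D insert_up_def Let_def)
  qed
  have down: "insert_down y \<in> carrier ?C \<and> insert_up (insert_down y) = y" if "y \<in> carrier ?D" for y
  proof -
    obtain a b where y: "y = (b, a)" "a \<in> columns m n r" "b \<in> letters m n" using \<open>y \<in> _\<close> D by auto
    then show ?thesis
      using bump_down_facts[OF y(2) assms(3) y(3)] insert_up_insert_down[OF y(2) assms(3) y(3)]
      by (simp add: C insert_down_def Let_def)
  qed
  have adj: "adjoint_at ?C i \<and> adjoint_at ?D i" if "i \<in> colours m n" for i
    using that by (simp add: adjoint_tensor normal_letter normal_column)
  have f: "f_op ?D i (insert_up x) = map_option insert_up (f_op ?C i x)"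
    if "i \<in> colours m n" "x \<in> carrier ?C" for i x
    using that insert_up_commutes_f assms(3) by (auto simp: C)
  have iso: "crystal_iso m n ?C ?D insert_up" "crystal_iso m n ?D ?C insert_down"
    by (rule crystal_iso_pairI[where F = insert_up and G = insert_down]; use up down adj f in blast)+
  show ?thesis
    unfolding column_crystal_simps(1) car Let_def
  proof (intro exI[of _ insert_up] exI[of _ insert_down] conjI iso ballI impI)
    show "insert_down (insert_up x) = x" if "x \<in> carrier ?C" for x using up that by blast
    show "insert_up (insert_down y) = y" if "y \<in> carrier ?D" for y using down that by blast
    fix a b assume ab: "a \<in> columns m n r" "b \<in> letters m n"
    note ab = ab(1) assms(3) ab(2)
    show "semistandard_column m n [last a, b] \<Longrightarrow> insert_up (a, b) = (hd a, tl a @ [b])"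
      by (rule insert_up_column[OF ab])
    show "semistandard_row m n [b, last a] \<Longrightarrow> insert_up (a, b) =
        (a ! (LEAST k. k < r \<and> semistandard_row m n [b, a ! k]),
         a[LEAST k. k < r \<and> semistandard_row m n [b, a ! k] := b])"
      by (rule insert_up_row[OF ab])
    show "semistandard_column m n [b, hd a] \<Longrightarrow> insert_down (b, a) = (b # butlast a, last a)"
      by (rule insert_down_column[OF ab])
    show "semistandard_row m n [hd a, b] \<Longrightarrow> insert_down (b, a) =
        (a[GREATEST k. k < r \<and> semistandard_row m n [a ! k, b] := b],
         a ! (GREATEST k. k < r \<and> semistandard_row m n [a ! k, b]))"
      by (rule insert_down_row[OF ab])
  qed
qed

end
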